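(* Let $(X,\tau)$ be a sequentially complete Hausdorff locally convex space, let $(T_t)_{t\ge 0}$ be a locally sequentially equicontinuous, equibounded $C_0$-semigroup on $(X,\tau)$, and let $(\mu_t)_{t\geq 0}$ be a convolution semigroup of sub-probability measures on $[0,\infty)$ which is vaguely continuous at $0$ with limit $\delta_0$. For $t\ge 0$ define $S_t\colon X\to X$ by the Pettis integral \[ S_t x:=\int_{[0,\infty)} T_s x\,\mu_t(\mathrm{d}s)\qquad (x\in X). \] Then $(S_t)_{t\ge 0}$ is a locally sequentially equicontinuous, equibounded $C_0$-semigroup on $(X,\tau)$. If moreover $(T_t)_{t\ge0}$ is sequentially equicontinuous, then $(S_t)_{t\ge 0}$ is sequentially equicontinuous as well.
   Context: Let the topology $\tau$ be generated by a directed family of seminorms $(\|\cdot\|_p)_{p\in\mathcal P}$. A semigroup $(T_t)_{t\ge 0}$ on $X$ is a family of linear operators $T_t\colon X\to X$ with $T_0=I$ and $T_{s+t}=T_sT_t$ for all $s,t\ge 0$. It is called: - a $C_0$-semigroup on $(X,\tau)$ if $\lim_{t\to 0+}T_tx=x$ for all $x\in X$; - locally sequentially equicontinuous if for every sequence $(x_n)$ in $X$ with $x_n\to 0$, every $t_0>0$ and every $p\in\mathcal P$ one has $\lim_{n\to\infty}\sup_{t\in[0,t_0]}\|T_tx_n\|_p=0$; sequentially equicontinuous if the same holds with $[0,t_0]$ replaced by $[0,\infty)$; - equibounded if $\sup_{x\in B,\,t\in[0,\infty)}\|T_tx\|_p<\infty$ for every bounded $B\subseteq X$ and every $p\in\mathcal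 P$. Pettis integral: for a measure space $(\Omega,\Sigma,\mu)$, a function $f\colon\Omega\to X$ such that $\langle x',f\rangle$ has a measurable representative and lies in $L^1(\Omega,\mu)$ for all $x'\in X'$ is $\mu$-Pettis-integrable if there is $x\in X$ with $\langle x',x\rangle=\int_\Omega\langle x',f(\omega)\rangle\,\mu(\mathrm{d}\omega)$ for all $x'\in X'$; then $x$ is unique and $\int_\Omega f\,\mathrm{d}\mu:=x$. A family $(\mu_t)_{t\ge0}$ of (positive) Radon measures on $[0,\infty)$ is a family of sub-probability measures if $\mu_t([0,\infty))\le 1$ for all $t$; a convolution semigroup if $\mu_0=\delta_0$ and $\mu_t*\mu_s=\mu_{t+s}$ for all $s,t\ge0$; vaguely continuous at $0$ with limit $\delta_0$ if $\lim_{t\to0}\int_{[0,\infty)}f\,\mathrm{d}\mu_t=f(0)$ for all continuous compactly supported $f$ on $[0,\infty)$. *)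

theory Defs
  imports "HOL-Probability.Probability"
begin

text \<open>
  The scalar field is any type \<open>'k\<close> of class \<open>{real_normed_field, euclidean_space}\<close>. Such a field
  has a multiplicative norm and finite dimension over the reals, so up to isometric isomorphism
  it is \<open>real\<close> or \<open>complex\<close>, and both of these types are instances. The real and the complex case
  are thus treated at once.
\<close>


subsection \<open>Locally convex spaces\<close>

definition seminorm :: "('k::real_normed_field \<Rightarrow> 'a::ab_group_add \<Rightarrow> 'a) \<Rightarrow> ('a \<Rightarrow> real) \<Rightarrow> bool" where
  "seminorm sc q \<longleftrightarrow>
     (\<forall>x. 0 \<le> q x) \<and>
     (\<forall>c x. q (sc c x) = norm c * q x) \<and>
     (\<forall>x y. q (x + y) \<le> q x + q y)"

text \<open>
  Directedness is required only up to a constant. This is the most permissive convention; it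
  includes families directed for the pointwise order (\<open>C = 1\<close>).
\<close>

definition directed_seminorms ::
  "('k::real_normed_field \<Rightarrow> 'a::ab_group_add \<Rightarrow> 'a) \<Rightarrow> 'i set \<Rightarrow> ('i \<Rightarrow> 'a \<Rightarrow> real) \<Rightarrow> bool" where
  "directed_seminorms sc I p \<longleftrightarrow>
     I \<noteq> {} \<and>
     (\<forall>i\<in>I. seminorm sc (p i)) \<and>
     (\<forall>i\<in>I. \<forall>j\<in>I. \<exists>k\<in>I. \<exists>C. \<forall>x. max (p i x) (p j x) \<le> C * p k x)"

definition locally_convex_space ::
  "('k::real_normed_field \<Rightarrow> 'a::ab_group_add \<Rightarrow> 'a) \<Rightarrow> 'a topology \<Rightarrow> 'i set \<Rightarrow> ('i \<Rightarrow> 'a \<Rightarrow> real) \<Rightarrow> bool" where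
  "locally_convex_space sc \<tau> I p \<longleftrightarrow>
     vector_space sc \<and>
     directed_seminorms sc I p \<and>
     \<tau> = topology_generated_by {{y. p i (y - x) < e} | i x e. i \<in> I \<and> e > 0}"

definition sequentially_complete ::
  "'a::ab_group_add topology \<Rightarrow> 'i set \<Rightarrow> ('i \<Rightarrow> 'a \<Rightarrow> real) \<Rightarrow> bool" where
  "sequentially_complete \<tau> I p \<longleftrightarrow>
     (\<forall>x :: nat \<Rightarrow> 'a.
        (\<forall>i\<in>I. \<forall>e>0. \<exists>N. \<forall>m\<ge>N. \<forall>n\<ge>N. p i (x m - x n) < e) \<longrightarrow>
        (\<exists>l. limitin \<tau> x l sequentially))"

definition bounded_set :: "'i set \<Rightarrow> ('i \<Rightarrow> 'a \<Rightarrow> real) \<Rightarrow> 'a set \<Rightarrow> bool" where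
  "bounded_set I p B \<longleftrightarrow> (\<forall>i\<in>I. bdd_above (p i ` B))"

definition continuous_dual ::
  "('k::{real_normed_field, euclidean_space} \<Rightarrow> 'a::ab_group_add \<Rightarrow> 'a) \<Rightarrow> 'a topology \<Rightarrow> ('a \<Rightarrow> 'k) set" where
  "continuous_dual sc \<tau> =
     {\<phi>. Vector_Spaces.linear sc (*) \<phi> \<and> continuous_map \<tau> euclidean \<phi>}"


subsection \<open>Semigroups of linear operators\<close>

text \<open>
  A family indexed by \<open>t \<ge> 0\<close> is a function on \<open>real\<close> whose values at negative arguments are
  irrelevant. The suprema are taken in \<open>ennreal\<close>, so that they exist also when infinite.
\<close>

definition C0_semigroup ::
  "('k::real_normed_field \<Rightarrow> 'a::ab_group_add \<Rightarrow> 'a) \<Rightarrow> 'a topology \<Rightarrow> (real \<Rightarrow> 'a \<Rightarrow> 'a) \<Rightarrow> bool" where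
  "C0_semigroup sc \<tau> T \<longleftrightarrow>
     (\<forall>t\<ge>0. Vector_Spaces.linear sc sc (T t)) \<and>
     T 0 = id \<and>
     (\<forall>s\<ge>0. \<forall>t\<ge>0. T (s + t) = T s \<circ> T t) \<and>
     (\<forall>x. limitin \<tau> (\<lambda>t. T t x) x (at_right 0))"

definition locally_sequentially_equicontinuous ::
  "'a::ab_group_add topology \<Rightarrow> 'i set \<Rightarrow> ('i \<Rightarrow> 'a \<Rightarrow> real) \<Rightarrow> (real \<Rightarrow> 'a \<Rightarrow> 'a) \<Rightarrow> bool" where
  "locally_sequentially_equicontinuous \<tau> I p T \<longleftrightarrow>
     (\<forall>x :: nat \<Rightarrow> 'a. limitin \<tau> x 0 sequentially \<longrightarrow>
        (\<forall>t0>0. \<forall>i\<in>I. (\<lambda>n. SUP t\<in>{0..t0}. ennreal (p i (T t (x n)))) \<longlonglongrightarrow> 0))"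

definition sequentially_equicontinuous ::
  "'a::ab_group_add topology \<Rightarrow> 'i set \<Rightarrow> ('i \<Rightarrow> 'a \<Rightarrow> real) \<Rightarrow> (real \<Rightarrow> 'a \<Rightarrow> 'a) \<Rightarrow> bool" where
  "sequentially_equicontinuous \<tau> I p T \<longleftrightarrow>
     (\<forall>x :: nat \<Rightarrow> 'a. limitin \<tau> x 0 sequentially \<longrightarrow>
        (\<forall>i\<in>I. (\<lambda>n. SUP t\<in>{0..}. ennreal (p i (T t (x n)))) \<longlonglongrightarrow> 0))"

definition equibounded :: "'i set \<Rightarrow> ('i \<Rightarrow> 'a \<Rightarrow> real) \<Rightarrow> (real \<Rightarrow> 'a \<Rightarrow> 'a) \<Rightarrow> bool" where
  "equibounded I p T \<longleftrightarrow>
     (\<forall>B. bounded_set I p B \<longrightarrow>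
        (\<forall>i\<in>I. (SUP (x, t)\<in>B \<times> {0..}. ennreal (p i (T t x))) < \<infinity>))"


subsection \<open>Pettis integral\<close>

definition has_pettis_integral ::
  "('k::{real_normed_field, euclidean_space} \<Rightarrow> 'a::ab_group_add \<Rightarrow> 'a) \<Rightarrow> 'a topology \<Rightarrow>
     'w measure \<Rightarrow> ('w \<Rightarrow> 'a) \<Rightarrow> 'a \<Rightarrow> bool" where
  "has_pettis_integral sc \<tau> M f x \<longleftrightarrow>
     (\<forall>\<phi>\<in>continuous_dual sc \<tau>.
        \<exists>g. integrable M g \<and> (AE \<omega> in M. \<phi> (f \<omega>) = g \<omega>) \<and> \<phi> x = (\<integral>\<omega>. g \<omega> \<partial>M))"

definition pettis_integrable ::
  "('k::{real_normed_field, euclidean_space} \<Rightarrow> 'a::ab_group_add \<Rightarrow> 'a) \<Rightarrow> 'a topology \<Rightarrow>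
     'w measure \<Rightarrow> ('w \<Rightarrow> 'a) \<Rightarrow> bool" where
  "pettis_integrable sc \<tau> M f \<longleftrightarrow> (\<exists>x. has_pettis_integral sc \<tau> M f x)"

definition pettis_integral ::
  "('k::{real_normed_field, euclidean_space} \<Rightarrow> 'a::ab_group_add \<Rightarrow> 'a) \<Rightarrow> 'a topology \<Rightarrow>
     'w measure \<Rightarrow> ('w \<Rightarrow> 'a) \<Rightarrow> 'a" where
  "pettis_integral sc \<tau> M f = (THE x. has_pettis_integral sc \<tau> M f x)"


subsection \<open>Convolution semigroups of sub-probability measures on the half-line\<close>

text \<open>
  A measure on \<open>[0,\<infinity>)\<close> is a Borel measure on \<open>real\<close> that vanishes on the negative half-line, which
  gives access to \<^const>\<open>convolution\<close>. No Radon condition is needed: a finite Borel measure on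
  \<open>real\<close> is automatically Radon.
\<close>

definition subprob_family :: "(real \<Rightarrow> real measure) \<Rightarrow> bool" where
  "subprob_family \<mu> \<longleftrightarrow>
     (\<forall>t\<ge>0. sets (\<mu> t) = sets borel \<and> emeasure (\<mu> t) {..<0} = 0 \<and> emeasure (\<mu> t) {0..} \<le> 1)"

definition convolution_semigroup :: "(real \<Rightarrow> real measure) \<Rightarrow> bool" where
  "convolution_semigroup \<mu> \<longleftrightarrow>
     \<mu> 0 = return borel 0 \<and>
     (\<forall>t\<ge>0. \<forall>s\<ge>0. convolution (\<mu> t) (\<mu> s) = \<mu> (t + s))"

definition vaguely_continuous_at_0 :: "(real \<Rightarrow> real measure) \<Rightarrow> bool" where
  "vaguely_continuous_at_0 \<mu> \<longleftrightarrow>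
     (\<forall>f :: real \<Rightarrow> real.
        continuous_on {0..} f \<and> compact (closure {s \<in> {0..}. f s \<noteq> 0}) \<longrightarrow>
        ((\<lambda>t. LINT s:{0..}|\<mu> t. f s) \<longlongrightarrow> f 0) (at_right 0))"

definition subordinated_semigroup ::
  "('k::{real_normed_field, euclidean_space} \<Rightarrow> 'a::ab_group_add \<Rightarrow> 'a) \<Rightarrow> 'a topology \<Rightarrow>
     (real \<Rightarrow> real measure) \<Rightarrow> (real \<Rightarrow> 'a \<Rightarrow> 'a) \<Rightarrow> real \<Rightarrow> 'a \<Rightarrow> 'a" where
  "subordinated_semigroup sc \<tau> \<mu> T t x =
     pettis_integral sc \<tau> (restrict_space (\<mu> t) {0..}) (\<lambda>s. T s x)"

end

theory Submission
  imports Defs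
begin

text \<open>
  Existence and uniqueness of the Pettis integrals rest on the estimate
  \<open>p i (\<integral> f) \<le> \<integral> p i \<circ> f\<close>, a consequence of the Hahn--Banach theorem: integrals of simple
  functions then form a Cauchy sequence. The operators \<open>T r\<close> are only sequentially continuous, so
  the integral is tested against all sequentially continuous functionals; since \<open>\<phi> \<circ> T r\<close> is again
  one of these, the semigroup law is Fubini's theorem for the convolution. The limit at \<open>0\<close> follows
  by splitting the orbit with a compactly supported cutoff. For local equicontinuity the integral is
  split at a level \<open>R\<close>: below \<open>R\<close> one uses local equicontinuity of \<open>T\<close>, above it equiboundedness
  together with the uniform smallness of the tails of \<open>\<mu> t\<close> for \<open>t\<close> in a bounded interval.
\<close>

subsection \<open>The Hahn--Banach theorem\<close>

text \<open>Each assumption controls a different region. Equiboundedness makes orbits bounded on the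
  whole half-line, so that they can be integrated against any finite measure, and it bounds what the
  tails of \<open>\<mu> t\<close> contribute. Local equicontinuity gives nothing uniform on the
  half-line, so it acts only below a level \<open>R\<close> that is fixed before the sequence index.
  Vague convergence sees compactly supported functions only and by itself would let mass escape to
  infinity. The bound 1 on the total mass prevents this: \<open>cutoff\<close> lies between 0 and 1
  on the half-line and its integral tends to 1, so the defect 1 - (integral of
  \<open>cutoff\<close>) tends to 0, and it dominates both the missing mass and the mass beyond 1.
  All estimates at small times come down to this defect. Algebraic identities for the integrals are
  tested by functionals, where they become identities of scalar Bochner integrals; estimates use
  only the seminorm inequality with a suitable scalar majorant.\<close>

definition sublinear :: "(real \<Rightarrow> 'a::ab_group_add \<Rightarrow> 'a) \<Rightarrow> ('a \<Rightarrow> real) \<Rightarrow> bool" where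
  "sublinear s q \<longleftrightarrow>
     (\<forall>x y. q (x + y) \<le> q x + q y) \<and> (\<forall>r\<ge>0. \<forall>x. q (s r x) = r * q x)"

text \<open>One inequality for positive scalars suffices: applied to \<open>inverse r\<close> and
  the vector \<open>s r x\<close> it yields the reverse one.\<close>

lemma sublinearI:
  fixes s :: "real \<Rightarrow> 'a::ab_group_add \<Rightarrow> 'a"
  assumes vs: "vector_space s"
    and add: "\<And>x y. q (x + y) \<le> q x + q y"
    and zero: "q 0 = 0"
    and le: "\<And>r x. 0 < r \<Longrightarrow> r * q x \<le> q (s r x)"
  shows "sublinear s q"
proof -
  interpret vector_space s by (rule vs)
  have "q (s r x) = r * q x" if "0 < r" for r x
  proof (rule antisym)
    have "inverse r * q (s r x) \<le> q (s (inverse r) (s r x))"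
      using that by (intro le) simp
    then show "q (s r x) \<le> r * q x"
      using that by (simp add: field_simps)
  qed (use le that in auto)
  then show ?thesis
    unfolding sublinear_def using add zero by (metis less_eq_real_def mult_zero_left scale_zero_left)
qed

lemma sublinear_zero:
  assumes "vector_space s" "sublinear s q"
  shows "q 0 = 0"
proof -
  interpret vector_space s by fact
  show ?thesis
    using assms(2) unfolding sublinear_def by (metis mult_zero_left order_refl scale_zero_left)
qed

text \<open>Subadditivity at x + (-x) = 0. It gives the lower bound that keeps infima over chains
  finite.\<close>

lemma sublinear_ge:
  assumes "vector_space s" "sublinear s q"
  shows "- q (- x) \<le> q x"
  using assms(2) sublinear_zero[OF assms] unfolding sublinear_def
  by (metis add.right_inverse add.commute minus_le_iff diff_ge_0_iff_ge diff_minus_eq_add)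

text \<open>Pushes \<open>q\<close> down along the ray spanned by \<open>y\<close> until it is odd
  in that direction. A minimal sublinear functional admits no such push and is therefore odd
  everywhere.\<close>

lemma sublinear_reduction:
  fixes s :: "real \<Rightarrow> 'a::ab_group_add \<Rightarrow> 'a"
  assumes vs: "vector_space s" and q: "sublinear s q"
  obtains q' where "sublinear s q'" "\<And>x. q' x \<le> q x" "q' (- y) \<le> - q y"
proof
  interpret vector_space s by (rule vs)
  \<comment> \<open>The parameter t = 0 gives \<open>q' x \<le> q x\<close>; t = 1 at the point
    \<open>- y\<close> gives \<open>q 0 - q y = - q y\<close>.\<close>
  define q' where "q' x = (INF t\<in>{0..}. q (x + s t y) - t * q y)" for x
  have add: "q (x + z) \<le> q x + q z" and hom: "0 \<le> r \<Longrightarrow> q (s r x) = r * q x" for x z r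
    using q by (auto simp: sublinear_def)
  have "- q (- x) \<le> q (x + s t y) - t * q y" if "0 \<le> t" for x t
    using add[of "x + s t y" "- x"] hom[OF that, of y] by simp
  then have bdd: "bdd_below ((\<lambda>t. q (x + s t y) - t * q y) ` {0..})" for x
    by (intro bdd_belowI2[where m = "- q (- x)"]) auto
  have lower: "q' x \<le> q (x + s t y) - t * q y" if "0 \<le> t" for x t
    unfolding q'_def using that by (intro cINF_lower bdd) auto
  have greatest: "c \<le> q' x" if "\<And>t. 0 \<le> t \<Longrightarrow> c \<le> q (x + s t y) - t * q y" for c x
    unfolding q'_def using that by (intro cINF_greatest) auto
  show "sublinear s q'"
  proof (rule sublinearI[OF vs])
    fix x z
    have "q' (x + z) \<le> (q (x + s t y) - t * q y) + (q (z + s u y) - u * q y)"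
      if "0 \<le> t" "0 \<le> u" for t u
      using lower[of "t + u" "x + z"] add[of "x + s t y" "z + s u y"] that
      by (simp add: algebra_simps)
    note * = this
    \<comment> \<open>With the \<open>t\<close>-term moved to the left, the infima over
      \<open>u\<close> and \<open>t\<close> can be taken one after the other.\<close>
    have "q' (x + z) - (q (x + s t y) - t * q y) \<le> q' z" if t: "0 \<le> t" for t
    proof (rule greatest)
      fix u :: real assume "0 \<le> u"
      with *[OF t this] show "q' (x + z) - (q (x + s t y) - t * q y) \<le> q (z + s u y) - u * q y"
        by linarith
    qed
    then have "q' (x + z) - q' z \<le> q' x"
      by (intro greatest) (simp add: algebra_simps)
    then show "q' (x + z) \<le> q' x + q' z" by simp
  next
    have "q' 0 = (INF t\<in>{0::real..}. 0)"
      unfolding q'_def by (intro INF_cong) (auto simp: hom)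
    then show "q' 0 = 0" by simp
  next
    fix r :: real and x assume r: "0 < r"
    show "r * q' x \<le> q' (s r x)"
    proof (rule greatest)
      fix t :: real assume t: "0 \<le> t"
      have "q (s r x + s t y) = q (s r (x + s (t / r) y))"
        using r by (simp add: scale_right_distrib)
      also have "\<dots> = r * q (x + s (t / r) y)"
        using r by (intro hom) simp
      finally have "q (s r x + s t y) - t * q y = r * (q (x + s (t / r) y) - t / r * q y)"
        using r by (simp add: field_simps)
      then show "r * q' x \<le> q (s r x + s t y) - t * q y"
        using lower[of "t / r" x] r t by simp
    qed
  qed
  show "q' x \<le> q x" for x
    using lower[of 0 x] by simp
  show "q' (- y) \<le> - q y"
    using lower[of 1 "- y"] sublinear_zero[OF vs q] by simp
qed

text \<open>Zorn's lemma for the reversed pointwise order; a nonempty chain is bounded by its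
  pointwise infimum.\<close>

lemma sublinear_minimal:
  fixes s :: "real \<Rightarrow> 'a::ab_group_add \<Rightarrow> 'a"
  assumes vs: "vector_space s" and p: "sublinear s p"
  obtains m where "sublinear s m" "m \<le> p" "\<And>q. sublinear s q \<Longrightarrow> q \<le> m \<Longrightarrow> q = m"
proof -
  interpret vector_space s by (rule vs)
  define A where "A = {q. sublinear s q \<and> q \<le> p}"
  have "\<exists>m\<in>A. \<forall>a\<in>A. a \<le> m \<longrightarrow> a = m"
  proof (rule predicate_Zorn[where P = "\<lambda>a b. b \<le> a"])
    show "partial_order_on A (relation_of (\<lambda>a b. b \<le> a) A)"
      by (rule partial_order_on_relation_ofI) auto
  next
    fix C assume C: "C \<in> Chains (relation_of (\<lambda>a b. b \<le> a) A)"
    then have chain: "\<And>a b. a \<in> C \<Longrightarrow> b \<in> C \<Longrightarrow> a \<le> b \<or> b \<le> a" and CA: "C \<subseteq> A"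
      unfolding Chains_def relation_of_def by auto
    show "\<exists>u\<in>A. \<forall>a\<in>C. u \<le> a"
    proof (cases "C = {}")
      case True
      then show ?thesis using p by (auto simp: A_def)
    next
      case ne: False
      define u where "u x = (INF q\<in>C. q x)" for x
      have add: "q (x + z) \<le> q x + q z" and hom: "0 \<le> r \<Longrightarrow> q (s r x) = r * q x"
        and le_p: "q x \<le> p x" if "q \<in> C" for q x z r
        using that CA by (auto simp: A_def sublinear_def le_fun_def)
      have "- p (- x) \<le> q x" if "q \<in> C" for q x
        using sublinear_ge[OF vs, of q x] le_p[OF that, of "- x"] that CA by (auto simp: A_def)
      then have bdd: "bdd_below ((\<lambda>q. q x) ` C)" for x
        by (intro bdd_belowI2[where m = "- p (- x)"]) auto
      have lower: "u x \<le> q x" if "q \<in> C" for q x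
        unfolding u_def using that by (intro cINF_lower bdd) auto
      have greatest: "c \<le> u x" if "\<And>q. q \<in> C \<Longrightarrow> c \<le> q x" for c x
        unfolding u_def using that ne by (intro cINF_greatest) auto
      have "sublinear s u"
      proof (rule sublinearI[OF vs])
        fix x z
        \<comment> \<open>Here the chain property enters: the smaller of \<open>a\<close> and
          \<open>b\<close> can be used at both points, and its own subadditivity applies.\<close>
        have "u (x + z) \<le> a x + b z" if "a \<in> C" "b \<in> C" for a b
          using chain[OF that]
        proof
          assume "a \<le> b"
          then have "a z \<le> b z" by (simp add: le_fun_def)
          then show ?thesis
            using add[OF that(1), of x z] lower[OF that(1), of "x + z"] by linarith
        next
          assume "b \<le> a"
          then have "b x \<le> a x" by (simp add: le_fun_def)
          then show ?thesis
            using add[OF that(2), of x z] lower[OF that(2), of "x + z"] by linarith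
        qed
        note * = this
        have "u (x + z) - a x \<le> u z" if a: "a \<in> C" for a
        proof (rule greatest)
          fix b assume "b \<in> C"
          with *[OF a this] show "u (x + z) - a x \<le> b z"
            by linarith
        qed
        then have "u (x + z) - u z \<le> u x"
          by (intro greatest) (simp add: algebra_simps)
        then show "u (x + z) \<le> u x + u z" by simp
      next
        have "u 0 = (INF q\<in>C. 0)"
          unfolding u_def using CA sublinear_zero[OF vs]
          by (intro INF_cong) (auto simp: A_def)
        then show "u 0 = 0" using ne by simp
      next
        fix r :: real and x assume r: "0 < r"
        then show "r * u x \<le> u (s r x)"
          by (intro greatest) (simp add: hom lower)
      qed
      moreover have "u \<le> p"
      proof (rule le_funI)
        fix x
        obtain q where "q \<in> C" using ne by blast
        then show "u x \<le> p x" using lower le_p order_trans by blast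
      qed
      ultimately show ?thesis
        using lower by (auto simp: A_def le_fun_def)
    qed
  qed
  then show ?thesis
    using that order_trans unfolding A_def by blast
qed

text \<open>A minimal sublinear functional is odd, since its reduction in any direction must
  coincide with it, and an odd subadditive functional is additive. Reducing \<open>p\<close> in the
  direction \<open>x0\<close> beforehand forces \<open>u (- x0) \<le> - p x0\<close>, hence equality
  at \<open>x0\<close>.\<close>

theorem hahn_banach_dominated:
  fixes s :: "real \<Rightarrow> 'a::ab_group_add \<Rightarrow> 'a"
  assumes vs: "vector_space s" and p: "sublinear s p"
  obtains u where "\<And>x y. u (x + y) = u x + u y" "\<And>r x. u (s r x) = r * u x"
    "\<And>x. u x \<le> p x" "u x0 = p x0"
proof -
  interpret vector_space s by (rule vs)
  obtain p' where p': "sublinear s p'" "\<And>x. p' x \<le> p x" "p' (- x0) \<le> - p x0"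
    using sublinear_reduction[OF vs p] by blast
  obtain u where u: "sublinear s u" "u \<le> p'" and min: "\<And>q. sublinear s q \<Longrightarrow> q \<le> u \<Longrightarrow> q = u"
    using sublinear_minimal[OF vs p'(1)] by blast
  have neg: "u (- y) = - u y" for y
  proof -
    obtain q where q: "sublinear s q" "\<And>x. q x \<le> u x" "q (- y) \<le> - u y"
      using sublinear_reduction[OF vs u(1)] by blast
    then have "q = u" by (intro min) (auto simp: le_fun_def)
    then show ?thesis
      using q(3) sublinear_ge[OF vs u(1), of y] by simp
  qed
  have sub: "u (x + y) \<le> u x + u y" for x y
    using u(1) by (auto simp: sublinear_def)
  have hom: "u (s r x) = r * u x" for r x
  proof (cases "0 \<le> r")
    case False
    then have "u (s (- r) x) = - r * u x"
      using u(1) unfolding sublinear_def by (metis linear neg_0_le_iff_le)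
    then show ?thesis by (simp add: neg)
  qed (use u(1) in \<open>auto simp: sublinear_def\<close>)
  have le: "u x \<le> p x" for x
    using u(2) p'(2)[of x] by (auto simp: le_fun_def intro: order_trans)
  show ?thesis
  proof
    show "u (x + y) = u x + u y" for x y
    proof -
      have "u (- x + - y) = - u (x + y)"
        using neg[of "x + y"] by simp
      then show ?thesis
        using sub[of x y] sub[of "- x" "- y"] neg[of x] neg[of y] by linarith
    qed
    show "u x0 = p x0"
    proof -
      have "u (- x0) \<le> p' (- x0)" using u(2) by (simp add: le_fun_def)
      then show ?thesis using le[of x0] p'(3) neg[of x0] by linarith
    qed
  qed (use hom le in auto)
qed

text \<open>
  The real functional \<open>u\<close> is read through the nondegenerate pairing \<open>(c, a) \<mapsto> (c * a) \<bullet> 1\<close> of the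
  scalar field with itself; for the complex numbers this is \<open>u x - \<i> * u (\<i> * x)\<close>.
\<close>
lemma scalar_valued_functional:
  fixes sc :: "'k::{real_normed_field, euclidean_space} \<Rightarrow> 'a::ab_group_add \<Rightarrow> 'a"
  assumes vs: "vector_space sc"
    and add: "\<And>x y. u (x + y) = u x + u y"
    and hom: "\<And>r x. u (sc (of_real r) x) = r * u x"
  obtains \<phi> C where "Vector_Spaces.linear sc (*) \<phi>" "\<And>x. \<phi> x \<bullet> 1 = u x"
    "0 < C" "\<And>q x. (\<And>c. \<bar>u (sc c x)\<bar> \<le> norm c * q) \<Longrightarrow> norm (\<phi> x) \<le> C * q"
proof -
  interpret vector_space sc by (rule vs)
  \<comment> \<open>\<open>L a\<close> is the Riesz vector of the real functional sending c to
    \<open>(c * a) \<bullet> 1\<close>. Testing it with \<open>inverse a\<close> shows that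
    \<open>L\<close> is injective, hence invertible in finite dimension.\<close>
  define L :: "'k \<Rightarrow> 'k" where "L a = (\<Sum>b\<in>Basis. ((b * a) \<bullet> 1) *\<^sub>R b)" for a
  have lin: "linear L"
    unfolding L_def
    by (rule linearI) (simp_all add: distrib_left inner_add_left scaleR_add_left sum.distrib scaleR_sum_right)
  have L_inner: "L a \<bullet> c = (c * a) \<bullet> 1" for a c
  proof -
    have "L a \<bullet> c = (\<Sum>b\<in>Basis. ((b * a) \<bullet> 1) * (c \<bullet> b))"
      by (simp add: L_def inner_sum_left inner_commute[of c])
    also have "\<dots> = (\<Sum>b\<in>Basis. ((c \<bullet> b) *\<^sub>R b) * a) \<bullet> 1"
      by (simp add: inner_sum_left mult.commute)
    also have "\<dots> = (c * a) \<bullet> 1"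
      by (simp only: sum_distrib_right[symmetric] euclidean_representation)
    finally show ?thesis .
  qed
  have "inj L"
  proof -
    have "a = 0" if "L a = 0" for a
    proof (rule ccontr)
      assume "a \<noteq> 0"
      then have "(1 :: 'k) \<bullet> 1 = 0"
        using L_inner[of a "inverse a"] that by simp
      then show False by simp
    qed
    then show ?thesis using lin by (simp add: linear_injective_0)
  qed
  then obtain G where G: "linear G" "\<And>a. L (G a) = a"
    using linear_injective_isomorphism[OF lin \<open>inj L\<close>] by blast
  \<comment> \<open>The sum is the Riesz vector of the real functional sending c to
    \<open>u (sc c x)\<close>; \<open>G\<close> turns it into the scalar that represents this
    functional under the pairing.\<close>
  define \<phi> where "\<phi> x = G (\<Sum>b\<in>Basis. u (sc b x) *\<^sub>R b)" for x
  have u_zero: "u 0 = 0" using hom[of 0 0] by simp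
  have u_sum: "u (sum f A) = (\<Sum>b\<in>A. u (f b))" if "finite A" for f and A :: "'k set"
    using that by (induction A rule: finite_induct) (simp_all add: u_zero add)
  have key: "(c * \<phi> x) \<bullet> 1 = u (sc c x)" for c x
  proof -
    have "(c * \<phi> x) \<bullet> 1 = (\<Sum>b\<in>Basis. u (sc b x) * (c \<bullet> b))"
      using L_inner[of "\<phi> x" c] by (simp add: \<phi>_def G inner_sum_left inner_commute[of c])
    also have "\<dots> = (\<Sum>b\<in>Basis. u (sc (of_real (c \<bullet> b)) (sc b x)))"
      by (simp only: hom) (simp only: mult.commute)
    also have "\<dots> = u (sc (\<Sum>b\<in>Basis. (c \<bullet> b) *\<^sub>R b) x)"
      by (simp add: u_sum scale_sum_left scaleR_conv_of_real)
    finally show ?thesis by (simp add: euclidean_representation)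
  qed
  have sep: "a = b" if "\<And>c. (c * a) \<bullet> 1 = (c * b) \<bullet> 1" for a b :: 'k
  proof -
    have "L a = L b" by (simp only: L_def that)
    then show ?thesis by (rule injD[OF \<open>inj L\<close>])
  qed
  have "bounded_linear G" using G(1) by (simp add: linear_conv_bounded_linear)
  then obtain K where K: "\<And>a. norm (G a) \<le> norm a * K" "0 < K"
    using bounded_linear.pos_bounded by blast
  show ?thesis
  proof
    show "Vector_Spaces.linear sc (*) \<phi>"
    proof (intro module_hom_iff_linear[THEN iffD1] module_hom.intro module_hom_axioms.intro)
      show "module sc" by (rule module_axioms)
      show "module ((*) :: 'k \<Rightarrow> 'k \<Rightarrow> 'k)" by unfold_locales (simp_all add: algebra_simps)
      show "\<phi> (x + y) = \<phi> x + \<phi> y" for x y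
        by (rule sep) (simp add: key scale_right_distrib add distrib_left inner_add_left)
      show "\<phi> (sc r x) = r * \<phi> x" for r x
        by (rule sep) (simp add: key flip: mult.assoc)
    qed
    show "\<phi> x \<bullet> 1 = u x" for x using key[of 1 x] by simp
    \<comment> \<open>\<open>K\<close> bounds the inverse \<open>G\<close>, and each of the
      \<open>DIM('k)\<close> coordinates contributes at most \<open>q\<close>, because basis vectors
      have norm 1.\<close>
    show "0 < K * DIM('k)" using K by simp
    fix q x assume *: "\<And>c. \<bar>u (sc c x)\<bar> \<le> norm c * q"
    have "norm (u (sc b x) *\<^sub>R b) \<le> q" if "b \<in> Basis" for b
      using *[of b] that by simp
    then have "norm (\<Sum>b\<in>Basis. u (sc b x) *\<^sub>R b) \<le> DIM('k) * q"
      by (intro order_trans[OF norm_sum] sum_bounded_above)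
    then have "norm (\<phi> x) \<le> (DIM('k) * q) * K"
      unfolding \<phi>_def using K(2) by (intro order_trans[OF K(1)] mult_right_mono) simp_all
    then show "norm (\<phi> x) \<le> K * DIM('k) * q" by (simp add: ac_simps)
  qed
qed

subsection \<open>Sequentially complete locally convex spaces\<close>

locale seq_complete_lcs =
  fixes sc :: "'k::{real_normed_field, euclidean_space} \<Rightarrow> 'a::ab_group_add \<Rightarrow> 'a"
    and \<tau> :: "'a topology"
    and I :: "'i set"
    and p :: "'i \<Rightarrow> 'a \<Rightarrow> real"
  assumes lcs: "locally_convex_space sc \<tau> I p"
    and hausdorff: "Hausdorff_space \<tau>"
    and complete: "sequentially_complete \<tau> I p"
begin

sublocale vs: vector_space sc
  using lcs by (simp add: locally_convex_space_def)

lemma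
  assumes "i \<in> I"
  shows seminorm_nonneg [simp]: "0 \<le> p i x"
    and seminorm_scale: "p i (sc c x) = norm c * p i x"
    and seminorm_add: "p i (x + y) \<le> p i x + p i y"
  using lcs assms unfolding locally_convex_space_def directed_seminorms_def seminorm_def by auto

lemma index_nonempty: "I \<noteq> {}"
  using lcs unfolding locally_convex_space_def directed_seminorms_def by auto

lemma seminorm_zero [simp]: "i \<in> I \<Longrightarrow> p i 0 = 0"
  using seminorm_scale[of i 0 0] by simp

lemma seminorm_minus: "i \<in> I \<Longrightarrow> p i (- x) = p i x"
  using seminorm_scale[of i "- 1" x] by simp

lemma seminorm_minus_commute: "i \<in> I \<Longrightarrow> p i (x - y) = p i (y - x)"
  using seminorm_minus[of i "x - y"] by simp

lemma seminorm_diff: "i \<in> I \<Longrightarrow> p i (x - y) \<le> p i x + p i y"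
  using seminorm_add[of i x "- y"] by (simp add: seminorm_minus)

lemma seminorm_triangle: "i \<in> I \<Longrightarrow> p i (x - z) \<le> p i (x - y) + p i (y - z)"
  using seminorm_add[of i "x - y" "y - z"] by simp

lemma seminorm_reverse_triangle: "i \<in> I \<Longrightarrow> \<bar>p i x - p i y\<bar> \<le> p i (x - y)"
  using seminorm_add[of i "x - y" y] seminorm_add[of i "y - x" x] seminorm_minus_commute[of i x y]
  by auto

section \<open>The topology expressed through its seminorms\<close>

lemma topology_eq: "\<tau> = topology_generated_by {{y. p i (y - x) < e} | i x e. i \<in> I \<and> e > 0}"
  using lcs by (simp add: locally_convex_space_def)

lemma openin_seminorm_ball: "i \<in> I \<Longrightarrow> 0 < e \<Longrightarrow> openin \<tau> {y. p i (y - x) < e}"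
  unfolding topology_eq openin_topology_generated_by_iff
  by (rule generate_topology_on.Basis) blast

lemma topspace_UNIV [simp]: "topspace \<tau> = UNIV"
proof -
  obtain i where "i \<in> I" using index_nonempty by blast
  then have "x \<in> topspace \<tau>" for x
    using openin_subset[OF openin_seminorm_ball[of i 1 x]] by auto
  then show ?thesis by auto
qed

text \<open>The balls, with arbitrary centres, form only a subbasis, so the converse direction is an
  induction over the generation of open sets.\<close>

lemma limitin_seminorm_iff:
  "limitin \<tau> f l F \<longleftrightarrow> (\<forall>i\<in>I. ((\<lambda>x. p i (f x - l)) \<longlongrightarrow> 0) F)"
proof
  assume lim: "limitin \<tau> f l F"
  show "\<forall>i\<in>I. ((\<lambda>x. p i (f x - l)) \<longlongrightarrow> 0) F"
  proof
    fix i assume i: "i \<in> I"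
    show "((\<lambda>x. p i (f x - l)) \<longlongrightarrow> 0) F"
    proof (rule tendstoI)
      fix e :: real assume e: "0 < e"
      then have "l \<in> {y. p i (y - l) < e}" using i by simp
      then have "\<forall>\<^sub>F x in F. f x \<in> {y. p i (y - l) < e}"
        using lim openin_seminorm_ball[OF i e] unfolding limitin_def by blast
      then show "\<forall>\<^sub>F x in F. dist (p i (f x - l)) 0 < e"
        using i by simp
    qed
  qed
next
  assume lim: "\<forall>i\<in>I. ((\<lambda>x. p i (f x - l)) \<longlongrightarrow> 0) F"
  have "\<forall>\<^sub>F x in F. f x \<in> U"
    if "generate_topology_on {{y. p i (y - x) < e} | i x e. i \<in> I \<and> e > 0} U" "l \<in> U" for U
    using that
  proof induction
    case (UN K)
    then obtain k where k: "k \<in> K" "l \<in> k" by blast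
    then have "\<forall>\<^sub>F x in F. f x \<in> k" by (rule UN.IH)
    then show ?case
      by (rule eventually_mono) (use k in blast)
  next
    case (Basis U)
    then obtain i x e where U: "U = {y. p i (y - x) < e}" "i \<in> I" by blast
    \<comment> \<open>The ball around \<open>x\<close> is recentred at \<open>l\<close>; the
      remaining radius is positive because \<open>l\<close> lies in the ball.\<close>
    have "\<forall>\<^sub>F y in F. p i (f y - l) < e - p i (l - x)"
      using order_tendstoD(2)[OF lim[rule_format, OF U(2)], of "e - p i (l - x)"] Basis U by simp
    then show ?case
      unfolding U(1) mem_Collect_eq
    proof (rule eventually_mono)
      fix y assume "p i (f y - l) < e - p i (l - x)"
      then show "p i (f y - x) < e"
        using seminorm_triangle[OF U(2), of "f y" x l] by simp
    qed
  qed (simp_all add: eventually_conj_iff)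
  then show "limitin \<tau> f l F"
    unfolding limitin_def topspace_UNIV
    by (subst topology_eq) (auto dest: openin_topology_generated_by)
qed

lemma limitin_0_iff: "limitin \<tau> f 0 F \<longleftrightarrow> (\<forall>i\<in>I. ((\<lambda>x. p i (f x)) \<longlongrightarrow> 0) F)"
  by (simp add: limitin_seminorm_iff)

text \<open>The constant sequence 0 would converge both to \<open>x\<close> and to 0, which the
  Hausdorff property forbids unless they agree.\<close>

lemma seminorm_separating:
  assumes "\<And>i. i \<in> I \<Longrightarrow> p i x \<le> 0"
  shows "x = 0"
proof (rule limitin_Hausdorff_unique[OF _ _ _ hausdorff])
  have "p i x = 0" if "i \<in> I" for i
    using assms that seminorm_nonneg[of i x] by (simp add: order_antisym)
  then show "limitin \<tau> (\<lambda>n. 0) x sequentially" "limitin \<tau> (\<lambda>n. 0) 0 sequentially"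
    by (auto simp: limitin_seminorm_iff seminorm_minus)
qed simp

lemma bounded_set_convergent:
  assumes "limitin \<tau> x 0 sequentially"
  shows "bounded_set I p (range x)"
  unfolding bounded_set_def
proof
  fix i assume i: "i \<in> I"
  then have "(\<lambda>n. p i (x n)) \<longlonglongrightarrow> 0"
    using assms by (simp add: limitin_0_iff)
  then have "Bseq (\<lambda>n. p i (x n))"
    by (intro convergent_imp_Bseq) (auto simp: convergent_def)
  then obtain K where "\<And>n. p i (x n) \<le> K"
    using i by (auto simp: Bseq_def)
  then show "bdd_above (p i ` range x)" by (intro bdd_aboveI[of _ K]) auto
qed

text \<open>Hahn-Banach with \<open>p i\<close> itself as the dominating sublinear functional. The
  full scalar functional is then bounded by a multiple of \<open>p i\<close>, since
  \<open>u (sc c y)\<close> is at most \<open>norm c * p i y\<close> in absolute value, and this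
  bound gives continuity.\<close>

lemma supporting_functional:
  assumes i: "i \<in> I"
  obtains \<phi> where "\<phi> \<in> continuous_dual sc \<tau>" "\<And>y. \<phi> y \<bullet> 1 \<le> p i y" "\<phi> x \<bullet> 1 = p i x"
proof -
  have vs: "vector_space (\<lambda>r. sc (of_real r))"
    by unfold_locales (simp_all add: vs.scale_right_distrib vs.scale_left_distrib)
  have "sublinear (\<lambda>r. sc (of_real r)) (p i)"
    using i by (auto simp: sublinear_def seminorm_add seminorm_scale)
  then obtain u where u: "\<And>x y. u (x + y) = u x + u y" "\<And>r x. u (sc (of_real r) x) = r * u x"
    "\<And>x. u x \<le> p i x" "u x = p i x"
    by (rule hahn_banach_dominated[OF vs]) blast
  obtain \<phi> C where lin: "Vector_Spaces.linear sc (*) \<phi>" and \<phi>: "\<And>x. \<phi> x \<bullet> 1 = u x" "0 < C"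
    "\<And>q x. (\<And>c. \<bar>u (sc c x)\<bar> \<le> norm c * q) \<Longrightarrow> norm (\<phi> x) \<le> C * q"
    using scalar_valued_functional[OF vs.vector_space_axioms u(1,2)] by blast
  have "u (- y) = - u y" for y
    using u(2)[of "- 1" y] by simp
  then have "\<bar>u y\<bar> \<le> p i y" for y
    using u(3)[of y] u(3)[of "- y"] by (simp add: seminorm_minus[OF i] abs_le_iff)
  then have bound: "norm (\<phi> y) \<le> C * p i y" for y
    by (intro \<phi>(3)) (simp flip: seminorm_scale[OF i])
  have diff: "\<phi> (y - z) = \<phi> y - \<phi> z" for y z
    using lin module_hom.diff module_hom_iff_linear by blast
  have "continuous_map \<tau> euclidean \<phi>"
    unfolding continuous_map_def
  proof (intro conjI allI impI)
    fix U :: "'k set" assume "openin euclidean U"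
    then have U: "open U" by simp
    show "openin \<tau> {y \<in> topspace \<tau>. \<phi> y \<in> U}"
    proof (subst openin_subopen, intro ballI)
      fix y assume "y \<in> {y \<in> topspace \<tau>. \<phi> y \<in> U}"
      then have "\<phi> y \<in> U" by simp
      then obtain e where e: "0 < e" "ball (\<phi> y) e \<subseteq> U"
        using openE[OF U] by blast
      have "\<phi> z \<in> U" if "p i (z - y) < e / C" for z
      proof -
        have "dist (\<phi> y) (\<phi> z) \<le> C * p i (z - y)"
          using bound[of "z - y"] by (simp add: diff dist_norm norm_minus_commute)
        also have "\<dots> < e" using that \<phi>(2) by (simp add: field_simps)
        finally show ?thesis using e(2) by (auto simp: subset_eq)
      qed
      moreover have "0 < e / C" using e \<phi>(2) by simp
      ultimately show "\<exists>V. openin \<tau> V \<and> y \<in> V \<and> V \<subseteq> {y \<in> topspace \<tau>. \<phi> y \<in> U}"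
        using i by (intro exI[of _ "{z. p i (z - y) < e / C}"]) (auto intro!: openin_seminorm_ball)
    qed
  qed simp
  then show ?thesis
    using that[of \<phi>] lin u(3,4) \<phi>(1) by (simp add: continuous_dual_def)
qed

section \<open>Sequentially continuous functionals\<close>

definition seq_dual :: "('a \<Rightarrow> 'k) set" where
  "seq_dual = {\<phi>. Vector_Spaces.linear sc (*) \<phi> \<and>
     (\<forall>x l. limitin \<tau> x l sequentially \<longrightarrow> (\<lambda>n. \<phi> (x n)) \<longlonglongrightarrow> \<phi> l)}"

lemma continuous_dual_subset_seq_dual: "continuous_dual sc \<tau> \<subseteq> seq_dual"
proof
  fix \<phi> assume \<phi>: "\<phi> \<in> continuous_dual sc \<tau>"
  have "(\<lambda>n. \<phi> (x n)) \<longlonglongrightarrow> \<phi> l" if "limitin \<tau> x l sequentially" for x l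
    using continuous_map_limit[of \<tau> euclidean \<phi>, OF _ that] \<phi>
    by (simp add: continuous_dual_def o_def)
  then show "\<phi> \<in> seq_dual"
    using \<phi> by (simp add: seq_dual_def continuous_dual_def)
qed

lemma seq_dualD:
  assumes "\<phi> \<in> seq_dual"
  shows "\<phi> (x + y) = \<phi> x + \<phi> y" "\<phi> (x - y) = \<phi> x - \<phi> y" "\<phi> (sc c x) = c * \<phi> x" "\<phi> 0 = 0"
    "\<phi> (sum g A) = (\<Sum>a\<in>A. \<phi> (g a))"
    "limitin \<tau> X l sequentially \<Longrightarrow> (\<lambda>n. \<phi> (X n)) \<longlonglongrightarrow> \<phi> l"
proof -
  have "Vector_Spaces.linear sc (*) \<phi>" using assms by (simp add: seq_dual_def)
  then interpret Vector_Spaces.linear sc "(*)" \<phi> .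
  show "\<phi> (x + y) = \<phi> x + \<phi> y" "\<phi> (x - y) = \<phi> x - \<phi> y" "\<phi> (sc c x) = c * \<phi> x" "\<phi> 0 = 0"
    "\<phi> (sum g A) = (\<Sum>a\<in>A. \<phi> (g a))"
    by (simp_all add: add diff scale sum)
qed (use assms in \<open>auto simp: seq_dual_def\<close>)

text \<open>Sequential continuity provides no dominating seminorm, so the bound comes from
  rescaling: if \<open>\<phi>\<close> exceeded n + 1 at some \<open>y n\<close> in \<open>B\<close>,
  the vectors \<open>y n\<close> divided by n + 1 would tend to 0 while their images keep norm at
  least 1.\<close>

lemma seq_dual_bounded:
  assumes \<phi>: "\<phi> \<in> seq_dual" and B: "bounded_set I p B"
  obtains K where "\<And>y. y \<in> B \<Longrightarrow> norm (\<phi> y) \<le> K"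
proof (rule ccontr)
  assume no: "\<not> thesis"
  have "\<exists>y\<in>B. real (Suc n) < norm (\<phi> y)" for n
    using that no by (meson not_le)
  then obtain y where y: "\<And>n. y n \<in> B" "\<And>n. real (Suc n) < norm (\<phi> (y n))"
    by metis
  define z where "z n = sc (of_real (1 / real (Suc n))) (y n)" for n
  have norm_scalar: "norm (of_real (1 / real (Suc n)) :: 'k) = 1 / real (Suc n)" for n
    by (simp del: of_nat_Suc of_real_divide)
  have "limitin \<tau> z 0 sequentially"
    unfolding limitin_0_iff
  proof
    fix i assume i: "i \<in> I"
    then obtain C where C: "\<And>y. y \<in> B \<Longrightarrow> p i y \<le> C"
      using B unfolding bounded_set_def bdd_above_def by (meson imageI)
    show "(\<lambda>n. p i (z n)) \<longlonglongrightarrow> 0"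
    proof (rule tendsto_sandwich[OF always_eventually always_eventually tendsto_const])
      show "(\<lambda>n. C * (1 / real (Suc n))) \<longlonglongrightarrow> 0"
        using tendsto_mult_right_zero[OF LIMSEQ_inverse_real_of_nat] by (simp add: field_simps)
      show "\<forall>n. p i (z n) \<le> C * (1 / real (Suc n))"
        using C[OF y(1)] unfolding z_def seminorm_scale[OF i] norm_scalar
        by (simp add: divide_right_mono del: of_nat_Suc)
    qed (use i in simp)
  qed
  then have "(\<lambda>n. \<phi> (z n)) \<longlonglongrightarrow> 0"
    using seq_dualD(4,6)[OF \<phi>] by metis
  moreover have "1 \<le> norm (\<phi> (z n))" for n
    using y(2)[of n] unfolding z_def seq_dualD(3)[OF \<phi>] norm_mult norm_scalar
    by (simp add: field_simps del: of_nat_Suc)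
  ultimately show False
    using LIMSEQ_le_const[of "\<lambda>n. norm (\<phi> (z n))" 0 1] tendsto_norm_zero by fastforce
qed

section \<open>Pettis integrals: seminorm estimate, uniqueness and separation\<close>

lemma has_pettis_integralI:
  assumes "\<And>\<phi>. \<phi> \<in> continuous_dual sc \<tau> \<Longrightarrow>
    has_bochner_integral M (\<lambda>\<omega>. \<phi> (f \<omega>)) (\<phi> x)"
  shows "has_pettis_integral sc \<tau> M f x"
  unfolding has_pettis_integral_def
proof
  fix \<phi> assume "\<phi> \<in> continuous_dual sc \<tau>"
  from assms[OF this] show "\<exists>g. integrable M g \<and> (AE \<omega> in M. \<phi> (f \<omega>) = g \<omega>) \<and> \<phi> x = (\<integral>\<omega>. g \<omega> \<partial>M)"
    by (intro exI[of _ "\<lambda>\<omega>. \<phi> (f \<omega>)"]) (simp add: has_bochner_integral_iff)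
qed

lemma has_pettis_integral_diff:
  assumes "has_pettis_integral sc \<tau> M f x" "has_pettis_integral sc \<tau> M g y"
  shows "has_pettis_integral sc \<tau> M (\<lambda>\<omega>. f \<omega> - g \<omega>) (x - y)"
  unfolding has_pettis_integral_def
proof
  fix \<phi> assume \<phi>: "\<phi> \<in> continuous_dual sc \<tau>"
  obtain u where u: "integrable M u" "AE \<omega> in M. \<phi> (f \<omega>) = u \<omega>" "\<phi> x = (\<integral>\<omega>. u \<omega> \<partial>M)"
    using assms(1) \<phi> unfolding has_pettis_integral_def by blast
  obtain v where v: "integrable M v" "AE \<omega> in M. \<phi> (g \<omega>) = v \<omega>" "\<phi> y = (\<integral>\<omega>. v \<omega> \<partial>M)"
    using assms(2) \<phi> unfolding has_pettis_integral_def by blast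
  have d: "\<phi> (a - b) = \<phi> a - \<phi> b" for a b
    using seq_dualD(2) continuous_dual_subset_seq_dual \<phi> by blast
  have "AE \<omega> in M. \<phi> (f \<omega> - g \<omega>) = u \<omega> - v \<omega>"
    using u(2) v(2) by eventually_elim (simp add: d)
  then show "\<exists>h. integrable M h \<and> (AE \<omega> in M. \<phi> (f \<omega> - g \<omega>) = h \<omega>) \<and> \<phi> (x - y) = (\<integral>\<omega>. h \<omega> \<partial>M)"
    using u v by (intro exI[of _ "\<lambda>\<omega>. u \<omega> - v \<omega>"]) (simp add: d)
qed

text \<open>The functional supporting \<open>p i\<close> at \<open>x\<close> turns the left side
  into a scalar integral. The majorant \<open>h\<close> is left free so that bounds assembled from
  cutoffs and indicators can be inserted.\<close>

lemma has_pettis_integral_seminorm_le: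
  assumes x: "has_pettis_integral sc \<tau> M f x" and i: "i \<in> I"
    and h: "integrable M h" "\<And>\<omega>. \<omega> \<in> space M \<Longrightarrow> p i (f \<omega>) \<le> h \<omega>"
  shows "p i x \<le> (\<integral>\<omega>. h \<omega> \<partial>M)"
proof -
  obtain \<phi> where \<phi>: "\<phi> \<in> continuous_dual sc \<tau>" "\<And>y. \<phi> y \<bullet> 1 \<le> p i y" "\<phi> x \<bullet> 1 = p i x"
    using supporting_functional[OF i] by blast
  obtain g where g: "integrable M g" "AE \<omega> in M. \<phi> (f \<omega>) = g \<omega>" "\<phi> x = (\<integral>\<omega>. g \<omega> \<partial>M)"
    using x \<phi>(1) unfolding has_pettis_integral_def by blast
  have "p i x = (\<integral>\<omega>. g \<omega> \<bullet> 1 \<partial>M)"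
    using \<phi>(3) g by simp
  also have "\<dots> \<le> (\<integral>\<omega>. h \<omega> \<partial>M)"
  proof (rule integral_mono_AE[OF _ h(1)])
    show "AE \<omega> in M. g \<omega> \<bullet> 1 \<le> h \<omega>"
      using g(2) AE_space
    proof eventually_elim
      case (elim \<omega>)
      then show ?case using \<phi>(2)[of "f \<omega>"] h(2)[of \<omega>] by simp
    qed
  qed (use g in simp)
  finally show ?thesis .
qed

text \<open>The difference is a Pettis integral of the zero function, so the seminorm estimate
  applies with majorant 0.\<close>

lemma has_pettis_integral_unique:
  assumes "has_pettis_integral sc \<tau> M f x" "has_pettis_integral sc \<tau> M f y"
  shows "x = y"
proof -
  have "p i (x - y) \<le> 0" if "i \<in> I" for i
    using has_pettis_integral_seminorm_le[OF has_pettis_integral_diff[OF assms] that, of "\<lambda>_. 0"] that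
    by simp
  then have "x - y = 0" by (rule seminorm_separating)
  then show ?thesis by simp
qed

lemma pettis_integral_eqI: "has_pettis_integral sc \<tau> M f x \<Longrightarrow> pettis_integral sc \<tau> M f = x"
  unfolding pettis_integral_def using has_pettis_integral_unique by blast

text \<open>Supporting functionals are continuous, hence lie in \<open>seq_dual\<close>, and they
  detect every seminorm of \<open>x - y\<close>.\<close>

lemma seq_dual_eqI:
  assumes "\<And>\<phi>. \<phi> \<in> seq_dual \<Longrightarrow> \<phi> x = \<phi> y"
  shows "x = y"
proof -
  have "p i (x - y) \<le> 0" if i: "i \<in> I" for i
  proof -
    obtain \<phi> where \<phi>: "\<phi> \<in> continuous_dual sc \<tau>" "\<phi> (x - y) \<bullet> 1 = p i (x - y)"
      using supporting_functional[OF i] by metis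
    then have "\<phi> \<in> seq_dual" using continuous_dual_subset_seq_dual by blast
    then show ?thesis using \<phi>(2) assms[of \<phi>] seq_dualD(2)[of \<phi> x y] by simp
  qed
  then have "x - y = 0" by (rule seminorm_separating)
  then show ?thesis by simp
qed

end

subsection \<open>Pettis integrals over the half-line\<close>

lemma integrable_halfline_bounded:
  fixes g :: "real \<Rightarrow> 'b::{banach, second_countable_topology}"
  assumes M: "finite_measure M" "sets M = sets (restrict_space borel {0..})"
    and g: "continuous_on {0..} g" "\<And>s. 0 \<le> s \<Longrightarrow> norm (g s) \<le> K"
  shows "integrable M g"
proof (rule finite_measure.integrable_const_bound[OF M(1)])
  have "space M = {0..}"
    using sets_eq_imp_space_eq[OF M(2)] by (simp add: space_restrict_space)
  then show "AE s in M. norm (g s) \<le> K"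
    using g(2) by (intro AE_I2) auto
  show "g \<in> borel_measurable M"
    using borel_measurable_continuous_on_restrict[OF g(1)] measurable_cong_sets[OF M(2) refl] by blast
qed

context seq_complete_lcs
begin

text \<open>The half-line is metrizable, so continuity there is sequential; in this form it composes
  directly with functionals that are only sequentially continuous.\<close>

definition halfline_continuous :: "(real \<Rightarrow> 'a) \<Rightarrow> bool" where
  "halfline_continuous f \<longleftrightarrow>
     (\<forall>X a. (\<forall>n. 0 \<le> X n) \<longrightarrow> 0 \<le> a \<longrightarrow> X \<longlonglongrightarrow> a \<longrightarrow>
        limitin \<tau> (\<lambda>n. f (X n)) (f a) sequentially)"

lemma halfline_continuous_seminorm:
  assumes f: "halfline_continuous f" and i: "i \<in> I"
  shows "continuous_on {0..} (\<lambda>s. p i (f s - y))"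
  unfolding continuous_on_sequentially
proof (intro allI ballI impI, elim conjE)
  fix X :: "nat \<Rightarrow> real" and a :: real
  assume X: "a \<in> {0..}" "\<forall>n. X n \<in> {0..}" "X \<longlonglongrightarrow> a"
  then have "(\<lambda>n. p i (f (X n) - f a)) \<longlonglongrightarrow> 0"
    using f i by (auto simp: halfline_continuous_def limitin_seminorm_iff)
  then have "(\<lambda>n. p i (f (X n) - y) - p i (f a - y)) \<longlonglongrightarrow> 0"
    by (rule Lim_null_comparison[rotated])
      (use seminorm_reverse_triangle[OF i, of "f _ - y" "f a - y"] in \<open>auto intro!: always_eventually\<close>)
  then show "((\<lambda>s. p i (f s - y)) \<circ> X) \<longlonglongrightarrow> p i (f a - y)"
    unfolding o_def by (rule LIM_zero_cancel)
qed

lemma halfline_continuous_functional: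
  assumes "halfline_continuous f" "\<phi> \<in> seq_dual"
  shows "continuous_on {0..} (\<lambda>s. \<phi> (f s))"
  using assms seq_dualD(6)[OF assms(2)] unfolding continuous_on_sequentially halfline_continuous_def o_def
  by auto

text \<open>On the measurable fibres of \<open>G\<close> the function \<open>f \<circ> G\<close> is
  constant, whatever \<open>f\<close> is. The vector in the conclusion does not depend on
  \<open>\<phi>\<close>, so it is an integral for all functionals at once.\<close>

lemma simple_pettis_integral:
  assumes M: "finite_measure M" and G: "simple_function M G"
    and \<phi>: "\<phi> \<in> seq_dual"
  shows "has_bochner_integral M (\<lambda>\<omega>. \<phi> (f (G \<omega>)))
    (\<phi> (\<Sum>v\<in>G ` space M. sc (of_real (measure M (G -` {v} \<inter> space M))) (f v)))"
proof -
  interpret finite_measure M by fact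
  let ?A = "\<lambda>v. G -` {v} \<inter> space M"
  have fin: "finite (G ` space M)" and meas: "v \<in> G ` space M \<Longrightarrow> ?A v \<in> sets M" for v
    using G by (auto simp: simple_function_def)
  have "has_bochner_integral M (\<lambda>\<omega>. \<Sum>v\<in>G ` space M. indicator (?A v) \<omega> *\<^sub>R \<phi> (f v))
    (\<Sum>v\<in>G ` space M. measure M (?A v) *\<^sub>R \<phi> (f v))"
    by (intro has_bochner_integral_sum has_bochner_integral_scaleR_left
        has_bochner_integral_real_indicator meas) (auto simp: less_top[symmetric])
  moreover have "(\<Sum>v\<in>G ` space M. indicator (?A v) \<omega> *\<^sub>R \<phi> (f v)) = \<phi> (f (G \<omega>))"
    if \<omega>: "\<omega> \<in> space M" for \<omega>
  proof -
    have "(\<Sum>v\<in>G ` space M. indicator (?A v) \<omega> *\<^sub>R \<phi> (f v)) =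
        (\<Sum>v\<in>G ` space M. if G \<omega> = v then \<phi> (f v) else 0)"
      using \<omega> by (intro sum.cong) (auto simp: indicator_def)
    then show ?thesis using fin \<omega> by simp
  qed
  ultimately show ?thesis
    by (simp add: seq_dualD[OF \<phi>] scaleR_conv_of_real cong: has_bochner_integral_cong)
qed

text \<open>
  The integral is the limit of the integrals of \<open>f \<circ> G n\<close>, where the simple functions \<open>G n\<close>
  approximate the identity of the half-line. It is characterised by the sequentially continuous
  functionals, not only by the continuous ones; this is what allows sequentially continuous
  operators to be pulled under the integral.
\<close>
lemma pettis_integral_exists:
  assumes M: "finite_measure M" "sets M = sets (restrict_space borel {0..})"
    and f: "halfline_continuous f" and bdd: "bounded_set I p (f ` {0..})"
  obtains x where "\<And>\<phi>. \<phi> \<in> seq_dual \<Longrightarrow> has_bochner_integral M (\<lambda>s. \<phi> (f s)) (\<phi> x)"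
proof -
  have space: "space M = {0..}"
    using sets_eq_imp_space_eq[OF M(2)] by (simp add: space_restrict_space)
  have meas: "g \<in> borel_measurable M" if "continuous_on {0..} g" for g :: "real \<Rightarrow> 'b::topological_space"
    using borel_measurable_continuous_on_restrict[OF that] measurable_cong_sets[OF M(2) refl] by blast
  have "(\<lambda>s::real. s) \<in> borel_measurable M"
    by (intro meas continuous_intros)
  from borel_measurable_implies_sequence_metric[OF this, of 0] obtain F where
    F: "\<And>n. simple_function M (F n)" "\<And>s. s \<in> space M \<Longrightarrow> (\<lambda>n. F n s) \<longlonglongrightarrow> s"
    by blast
  \<comment> \<open>The approximations \<open>F n\<close> may take negative values, where
    \<open>f\<close> is not controlled. Clipping at 0 keeps them in the half-line and preserves the
    limit, which is nonnegative.\<close>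
  define G where "G n = max 0 \<circ> F n" for n
  have G: "simple_function M (G n)" "0 \<le> G n s" for n s
    using simple_function_compose[OF F(1), of "max 0" n] by (auto simp: G_def o_def)
  have G_lim: "(\<lambda>n. G n s) \<longlonglongrightarrow> s" if "s \<in> space M" for s
    using tendsto_max[OF tendsto_const[of 0] F(2)[OF that]] that by (simp add: G_def space max_def)
  define x where "x n = (\<Sum>v\<in>G n ` space M. sc (of_real (measure M (G n -` {v} \<inter> space M))) (f v))" for n
  have simple: "has_bochner_integral M (\<lambda>s. \<phi> (f (G n s))) (\<phi> (x n))" if "\<phi> \<in> seq_dual" for \<phi> n
    unfolding x_def by (rule simple_pettis_integral[OF M(1) G(1) that])
  have pettis: "has_pettis_integral sc \<tau> M (\<lambda>s. f (G n s)) (x n)" for n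
    using simple continuous_dual_subset_seq_dual by (intro has_pettis_integralI) auto
  \<comment> \<open>Dominated convergence: the error is at most \<open>2 * K\<close> because the
    values of \<open>f\<close> are bounded in \<open>p i\<close>, and it tends to 0 at each point by
    continuity.\<close>
  have D: "integrable M (\<lambda>s. p i (f (G n s) - f s))"
    "(\<lambda>n. \<integral>s. p i (f (G n s) - f s) \<partial>M) \<longlonglongrightarrow> 0" if i: "i \<in> I" for i n
  proof -
    obtain K where K: "\<And>s. 0 \<le> s \<Longrightarrow> p i (f s) \<le> K"
      using bdd i unfolding bounded_set_def bdd_above_def by (metis atLeast_iff imageI)
    have bound: "p i (f s - f t) \<le> 2 * K" if "0 \<le> s" "0 \<le> t" for s t
      using seminorm_diff[OF i, of "f s" "f t"] K[OF that(1)] K[OF that(2)] by linarith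
    \<comment> \<open>On the fibre where \<open>G n\<close> equals v the error is
      \<open>p i (f s - f v)\<close>, a continuous function of s; a finite sum over the fibres is
      therefore measurable.\<close>
    have D_meas: "(\<lambda>s. p i (f (G n s) - f s)) \<in> borel_measurable M" for n
    proof -
      have "(\<lambda>s. \<Sum>v\<in>G n ` space M. indicator (G n -` {v} \<inter> space M) s * p i (f s - f v)) \<in> borel_measurable M"
        using G(1)[of n]
        by (intro borel_measurable_sum borel_measurable_times borel_measurable_indicator
            meas halfline_continuous_seminorm[OF f i]) (auto simp: simple_function_def)
      moreover have "(\<Sum>v\<in>G n ` space M. indicator (G n -` {v} \<inter> space M) s * p i (f s - f v)) =
          p i (f (G n s) - f s)" if s: "s \<in> space M" for s
      proof -
        have "(\<Sum>v\<in>G n ` space M. indicator (G n -` {v} \<inter> space M) s * p i (f s - f v)) =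
            (\<Sum>v\<in>G n ` space M. if G n s = v then p i (f s - f v) else 0)"
          using s by (intro sum.cong) (auto simp: indicator_def)
        then show ?thesis
          using G(1)[of n] s by (simp add: simple_function_def seminorm_minus_commute[OF i])
      qed
      ultimately show ?thesis
        by (simp cong: measurable_cong)
    qed
    have lim: "(\<lambda>n. p i (f (G n s) - f s)) \<longlonglongrightarrow> 0" if "s \<in> space M" for s
      using f G(2) G_lim[OF that] that i unfolding halfline_continuous_def limitin_seminorm_iff space by simp
    have const: "integrable M (\<lambda>_. 2 * K)"
      by (rule finite_measure.integrable_const[OF M(1)])
    show "integrable M (\<lambda>s. p i (f (G n s) - f s))"
      using bound G(2) i
      by (intro finite_measure.integrable_const_bound[OF M(1), of _ "2 * K"] AE_I2 D_meas)
        (simp add: space)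
    have "(\<lambda>n. \<integral>s. p i (f (G n s) - f s) \<partial>M) \<longlonglongrightarrow> (\<integral>s. 0 \<partial>M)"
      using bound G(2) i
      by (intro integral_dominated_convergence[OF _ D_meas const] AE_I2 lim) (simp_all add: space)
    then show "(\<lambda>n. \<integral>s. p i (f (G n s) - f s) \<partial>M) \<longlonglongrightarrow> 0" by simp
  qed
  \<comment> \<open>The two simple integrals are compared with \<open>f\<close> under the integral
    sign, as no integral of \<open>f\<close> is available yet.\<close>
  have cauchy: "p i (x m - x n) \<le> (\<integral>s. p i (f (G m s) - f s) \<partial>M) + (\<integral>s. p i (f (G n s) - f s) \<partial>M)"
    if i: "i \<in> I" for i m n
  proof -
    have "p i (x m - x n) \<le> (\<integral>s. p i (f (G m s) - f s) + p i (f (G n s) - f s) \<partial>M)"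
    proof (rule has_pettis_integral_seminorm_le[OF has_pettis_integral_diff[OF pettis pettis] i])
      show "p i (f (G m s) - f (G n s)) \<le> p i (f (G m s) - f s) + p i (f (G n s) - f s)" for s
        using seminorm_triangle[OF i, of "f (G m s)" "f (G n s)" "f s"]
        by (simp add: seminorm_minus_commute[OF i, of "f s"])
    qed (use D(1)[OF i] in simp)
    then show ?thesis using D(1)[OF i] by simp
  qed
  have "\<exists>N. \<forall>m\<ge>N. \<forall>n\<ge>N. p i (x m - x n) < e" if i: "i \<in> I" and e: "0 < e" for i e
  proof -
    have "\<forall>\<^sub>F n in sequentially. (\<integral>s. p i (f (G n s) - f s) \<partial>M) < e / 2"
      using order_tendstoD(2)[OF D(2)[OF i], of "e / 2"] e by simp
    then obtain N where N: "\<And>n. N \<le> n \<Longrightarrow> (\<integral>s. p i (f (G n s) - f s) \<partial>M) < e / 2"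
      by (auto simp: eventually_sequentially)
    then have "p i (x m - x n) < e" if "N \<le> m" "N \<le> n" for m n
      using cauchy[OF i, of m n] N[OF that(1)] N[OF that(2)] by linarith
    then show ?thesis by blast
  qed
  then obtain l where l: "limitin \<tau> x l sequentially"
    using complete unfolding sequentially_complete_def by meson
  show ?thesis
  proof
    fix \<phi> assume \<phi>: "\<phi> \<in> seq_dual"
    obtain K where K: "\<And>s. 0 \<le> s \<Longrightarrow> norm (\<phi> (f s)) \<le> K"
      using seq_dual_bounded[OF \<phi> bdd] by (metis atLeast_iff imageI)
    note cont = halfline_continuous_functional[OF f \<phi>]
    have "(\<lambda>n. \<integral>s. \<phi> (f (G n s)) \<partial>M) \<longlonglongrightarrow> (\<integral>s. \<phi> (f s) \<partial>M)"
    proof (rule integral_dominated_convergence[where w = "\<lambda>_. K"])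
      show "AE s in M. (\<lambda>n. \<phi> (f (G n s))) \<longlonglongrightarrow> \<phi> (f s)"
      proof (rule AE_I2)
        fix s assume s: "s \<in> space M"
        then have "limitin \<tau> (\<lambda>n. f (G n s)) (f s) sequentially"
          using f G(2) G_lim[OF s] unfolding halfline_continuous_def space by simp
        then show "(\<lambda>n. \<phi> (f (G n s))) \<longlonglongrightarrow> \<phi> (f s)" by (rule seq_dualD(6)[OF \<phi>])
      qed
      show "integrable M (\<lambda>_. K)" by (rule finite_measure.integrable_const[OF M(1)])
      show "(\<lambda>s. \<phi> (f s)) \<in> borel_measurable M" by (rule meas[OF cont])
      show "(\<lambda>s. \<phi> (f (G n s))) \<in> borel_measurable M" for n
        using simple[OF \<phi>, of n] by (auto simp: has_bochner_integral_iff)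
      show "AE s in M. norm (\<phi> (f (G n s))) \<le> K" for n
        using K G(2) by (intro AE_I2) simp
    qed
    moreover have "(\<integral>s. \<phi> (f (G n s)) \<partial>M) = \<phi> (x n)" for n
      using simple[OF \<phi>, of n] by (simp add: has_bochner_integral_iff)
    ultimately have "\<phi> l = (\<integral>s. \<phi> (f s) \<partial>M)"
      using LIMSEQ_unique seq_dualD(6)[OF \<phi> l] by simp
    then show "has_bochner_integral M (\<lambda>s. \<phi> (f s)) (\<phi> l)"
      using integrable_halfline_bounded[OF M cont K] by (simp add: has_bochner_integral_iff)
  qed
qed

text \<open>The vector constructed above is a Pettis integral, hence by uniqueness the one that
  \<open>pettis_integral\<close> selects. It thus satisfies the identity on all of
  \<open>seq_dual\<close>, although its definition tests only the continuous dual.\<close>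

lemma pettis_integral_functional:
  assumes M: "finite_measure M" "sets M = sets (restrict_space borel {0..})"
    and f: "halfline_continuous f" and bdd: "bounded_set I p (f ` {0..})"
  shows "has_pettis_integral sc \<tau> M f (pettis_integral sc \<tau> M f)"
    and "\<And>\<phi>. \<phi> \<in> seq_dual \<Longrightarrow>
      has_bochner_integral M (\<lambda>s. \<phi> (f s)) (\<phi> (pettis_integral sc \<tau> M f))"
proof -
  obtain x where x: "\<And>\<phi>. \<phi> \<in> seq_dual \<Longrightarrow> has_bochner_integral M (\<lambda>s. \<phi> (f s)) (\<phi> x)"
    using pettis_integral_exists[OF assms] by blast
  then have "has_pettis_integral sc \<tau> M f x"
    using continuous_dual_subset_seq_dual by (intro has_pettis_integralI) auto
  moreover from this have "pettis_integral sc \<tau> M f = x"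
    by (rule pettis_integral_eqI)
  ultimately show "has_pettis_integral sc \<tau> M f (pettis_integral sc \<tau> M f)"
    and "\<And>\<phi>. \<phi> \<in> seq_dual \<Longrightarrow>
      has_bochner_integral M (\<lambda>s. \<phi> (f s)) (\<phi> (pettis_integral sc \<tau> M f))"
    using x by simp_all
qed

end

subsection \<open>Equibounded semigroups\<close>

locale equibounded_C0_semigroup = seq_complete_lcs sc \<tau> I p
  for sc :: "'k::{real_normed_field, euclidean_space} \<Rightarrow> 'a::ab_group_add \<Rightarrow> 'a"
    and \<tau> :: "'a topology" and I :: "'i set" and p :: "'i \<Rightarrow> 'a \<Rightarrow> real" +
  fixes T :: "real \<Rightarrow> 'a \<Rightarrow> 'a"
  assumes C0: "C0_semigroup sc \<tau> T"
    and local_equicont: "locally_sequentially_equicontinuous \<tau> I p T"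
    and equibounded: "equibounded I p T"
begin

lemma T_linear: "0 \<le> t \<Longrightarrow> Vector_Spaces.linear sc sc (T t)"
  and T_zero: "T 0 x = x"
  and T_add: "0 \<le> s \<Longrightarrow> 0 \<le> t \<Longrightarrow> T (s + t) x = T s (T t x)"
  and T_lim: "limitin \<tau> (\<lambda>t. T t x) x (at_right 0)"
  using C0 by (auto simp: C0_semigroup_def)

lemma T_plus: "0 \<le> t \<Longrightarrow> T t (x + y) = T t x + T t y"
  and T_diff: "0 \<le> t \<Longrightarrow> T t (x - y) = T t x - T t y"
  and T_scale: "0 \<le> t \<Longrightarrow> T t (sc c x) = sc c (T t x)"
  using T_linear[of t] by (simp_all flip: module_hom_iff_linear add: module_hom.add module_hom.diff module_hom.scale)

lemma T_bounded:
  assumes "bounded_set I p B" "i \<in> I"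
  obtains K where "0 \<le> K" "\<And>x t. x \<in> B \<Longrightarrow> 0 \<le> t \<Longrightarrow> p i (T t x) \<le> K"
proof
  define S where "S = (SUP (x, t)\<in>B \<times> {0..}. ennreal (p i (T t x)))"
  have S: "S < \<infinity>" using equibounded assms by (simp add: equibounded_def S_def)
  fix x :: 'a and t :: real assume "x \<in> B" "0 \<le> t"
  then have "ennreal (p i (T t x)) \<le> S"
    unfolding S_def by (intro SUP_upper2[of "(x, t)"]) auto
  then have "ennreal (p i (T t x)) \<le> ennreal (enn2real S)"
    using S by (simp add: ennreal_enn2real)
  then show "p i (T t x) \<le> enn2real S"
    by (simp add: ennreal_le_iff)
qed simp

lemma T_local_equicont:
  assumes x: "limitin \<tau> x 0 sequentially" and i: "i \<in> I" and "0 < t0" "0 < e"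
  shows "\<forall>\<^sub>F n in sequentially. \<forall>t\<in>{0..t0}. p i (T t (x n)) < e"
proof -
  have "(\<lambda>n. SUP t\<in>{0..t0}. ennreal (p i (T t (x n)))) \<longlonglongrightarrow> 0"
    using local_equicont assms by (simp add: locally_sequentially_equicontinuous_def)
  then have "\<forall>\<^sub>F n in sequentially. (SUP t\<in>{0..t0}. ennreal (p i (T t (x n)))) < ennreal e"
    by (rule order_tendstoD(2)) (use \<open>0 < e\<close> in simp)
  then show ?thesis
  proof (rule eventually_mono, intro ballI)
    fix n t assume n: "(SUP t\<in>{0..t0}. ennreal (p i (T t (x n)))) < ennreal e" and t: "t \<in> {0..t0}"
    have "ennreal (p i (T t (x n))) < ennreal e"
      by (rule le_less_trans[OF SUP_upper[OF t] n])
    then show "p i (T t (x n)) < e" using i by (simp add: ennreal_less_iff)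
  qed
qed

lemma T_seq_continuous:
  assumes x: "limitin \<tau> x l sequentially" and t: "0 \<le> t"
  shows "limitin \<tau> (\<lambda>n. T t (x n)) (T t l) sequentially"
  unfolding limitin_seminorm_iff
proof
  fix i assume i: "i \<in> I"
  have x': "limitin \<tau> (\<lambda>n. x n - l) 0 sequentially"
    using x by (simp add: limitin_seminorm_iff)
  show "(\<lambda>n. p i (T t (x n) - T t l)) \<longlonglongrightarrow> 0"
  proof (rule tendstoI)
    fix e :: real assume "0 < e"
    \<comment> \<open>The interval ends at \<open>t + 1\<close> because its length must be positive
      and \<open>t\<close> may be 0.\<close>
    from T_local_equicont[OF x' i _ this, of "t + 1"] t
    have "\<forall>\<^sub>F n in sequentially. \<forall>t'\<in>{0..t + 1}. p i (T t' (x n - l)) < e" by simp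
    then show "\<forall>\<^sub>F n in sequentially. dist (p i (T t (x n) - T t l)) 0 < e"
      by (rule eventually_mono) (use t i in \<open>auto simp flip: T_diff\<close>)
  qed
qed

lemma seq_dual_compose_T:
  assumes "\<phi> \<in> seq_dual" "0 \<le> t"
  shows "(\<lambda>x. \<phi> (T t x)) \<in> seq_dual"
proof -
  have "Vector_Spaces.linear sc (*) \<phi>" using assms(1) by (simp add: seq_dual_def)
  with T_linear[OF assms(2)] have "Vector_Spaces.linear sc (*) (\<phi> \<circ> T t)"
    by (rule Vector_Spaces.linear_compose)
  then have "Vector_Spaces.linear sc (*) (\<lambda>x. \<phi> (T t x))" by (simp add: o_def)
  moreover have "(\<lambda>n. \<phi> (T t (x n))) \<longlonglongrightarrow> \<phi> (T t l)" if "limitin \<tau> x l sequentially" for x l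
    by (rule seq_dualD(6)[OF assms(1) T_seq_continuous[OF that assms(2)]])
  ultimately show ?thesis by (simp add: seq_dual_def)
qed

text \<open>By the semigroup law the increment between \<open>X n\<close> and \<open>a\<close> is,
  up to sign, T at the smaller time applied to \<open>y n\<close>. The smaller time never exceeds
  \<open>a\<close>, so local equicontinuity along the null sequence \<open>y\<close> covers approach
  from both sides.\<close>

lemma orbit_continuous: "halfline_continuous (\<lambda>s. T s x)"
  unfolding halfline_continuous_def limitin_seminorm_iff
proof (intro allI impI ballI)
  fix X :: "nat \<Rightarrow> real" and a i
  assume X: "\<forall>n. 0 \<le> X n" "0 \<le> a" "X \<longlonglongrightarrow> a" and i: "i \<in> I"
  define y where "y n = T \<bar>X n - a\<bar> x - x" for n
  have abs: "(\<lambda>n. \<bar>X n - a\<bar>) \<longlonglongrightarrow> 0"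
    using X(3) by (simp add: tendsto_rabs_zero_iff LIM_zero_iff)
  have y: "limitin \<tau> y 0 sequentially"
    unfolding limitin_0_iff
  proof
    fix j assume j: "j \<in> I"
    have "((\<lambda>t. p j (T t x - x)) \<longlongrightarrow> p j (T 0 x - x)) (at_right 0)"
      using T_lim j by (simp add: limitin_seminorm_iff T_zero)
    \<comment> \<open>The limit from the right excludes time 0, but the distances of
      \<open>X n\<close> to \<open>a\<close> may vanish; the value at 0 is adjoined before sequences
      are inserted.\<close>
    then have "((\<lambda>t. p j (T t x - x)) \<longlongrightarrow> p j (T 0 x - x)) (at 0 within {0..})"
      by (simp add: tendsto_at_iff_tendsto_nhds_within at_within_Ici_at_right)
    then have "continuous (at 0 within {0..}) (\<lambda>t. p j (T t x - x))"
      by (simp add: continuous_within)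
    then have "(\<lambda>n. p j (T \<bar>X n - a\<bar> x - x)) \<longlonglongrightarrow> p j (T 0 x - x)"
      using abs by (auto simp: continuous_within_sequentially o_def)
    then show "(\<lambda>n. p j (y n)) \<longlonglongrightarrow> 0" using j by (simp add: T_zero y_def)
  qed
  have eq: "p i (T (X n) x - T a x) = p i (T (min (X n) a) (y n))" for n
  proof (cases "X n \<le> a")
    case True
    then have "T a x = T (X n) (T \<bar>X n - a\<bar> x)"
      using X(1) T_add[of "X n" "a - X n" x] by simp
    then show ?thesis
      using True X(1) seminorm_minus_commute[OF i] by (simp add: y_def T_diff)
  next
    case False
    then have "T (X n) x = T a (T \<bar>X n - a\<bar> x)"
      using X(2) T_add[of a "X n - a" x] by simp
    then show ?thesis
      using False X(2) by (simp add: y_def T_diff)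
  qed
  show "(\<lambda>n. p i (T (X n) x - T a x)) \<longlonglongrightarrow> 0"
  proof (rule tendstoI)
    fix e :: real assume "0 < e"
    from T_local_equicont[OF y i _ this, of "a + 1"] X(2)
    have "\<forall>\<^sub>F n in sequentially. \<forall>t\<in>{0..a + 1}. p i (T t (y n)) < e" by simp
    then show "\<forall>\<^sub>F n in sequentially. dist (p i (T (X n) x - T a x)) 0 < e"
    proof (rule eventually_mono)
      fix n assume "\<forall>t\<in>{0..a + 1}. p i (T t (y n)) < e"
      then have "p i (T (min (X n) a) (y n)) < e"
        using X by (intro bspec[of "{0..a + 1}" "\<lambda>t. p i (T t (y n)) < e"]) auto
      then show "dist (p i (T (X n) x - T a x)) 0 < e"
        using i by (simp add: eq)
    qed
  qed
qed

lemma orbit_bounded: "bounded_set I p ((\<lambda>s. T s x) ` {0..})"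
  unfolding bounded_set_def
proof
  fix i assume i: "i \<in> I"
  have "bounded_set I p {x}" by (simp add: bounded_set_def)
  then obtain K where "\<And>y t. y \<in> {x} \<Longrightarrow> 0 \<le> t \<Longrightarrow> p i (T t y) \<le> K"
    using T_bounded[OF _ i] by metis
  then show "bdd_above (p i ` (\<lambda>s. T s x) ` {0..})"
    by (intro bdd_aboveI[of _ K]) auto
qed

end

subsection \<open>Convolution semigroups on the half-line\<close>

locale vaguely_continuous_convolution_semigroup =
  fixes \<mu> :: "real \<Rightarrow> real measure"
  assumes subprob: "subprob_family \<mu>"
    and convolution: "convolution_semigroup \<mu>"
    and vague: "vaguely_continuous_at_0 \<mu>"
begin

lemma sets_mu [simp]: "0 \<le> t \<Longrightarrow> sets (\<mu> t) = sets borel"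
  using subprob by (simp add: subprob_family_def)

lemma space_mu [simp]: "0 \<le> t \<Longrightarrow> space (\<mu> t) = UNIV"
  using sets_eq_imp_space_eq[OF sets_mu] by simp

lemma mu_nonneg: "0 \<le> t \<Longrightarrow> AE s in \<mu> t. 0 \<le> s"
  using subprob by (intro AE_I[of _ _ "{..<0}"]) (auto simp: subprob_family_def)

lemma emeasure_mu_le: assumes "0 \<le> t" shows "emeasure (\<mu> t) A \<le> 1"
proof -
  have "{..<0} \<union> {0..} = (UNIV :: real set)" by auto
  then have "emeasure (\<mu> t) A \<le> emeasure (\<mu> t) ({..<0} \<union> {0..})"
    using assms emeasure_space[of "\<mu> t" A] by simp
  also have "\<dots> \<le> emeasure (\<mu> t) {..<0} + emeasure (\<mu> t) {0..}"
    using assms by (intro emeasure_subadditive) simp_all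
  also have "\<dots> \<le> 1"
    using subprob assms by (simp add: subprob_family_def)
  finally show ?thesis .
qed

lemma finite_mu: "0 \<le> t \<Longrightarrow> finite_measure (\<mu> t)"
  using emeasure_mu_le[of t "space (\<mu> t)"]
  by (intro finite_measureI) (auto simp: top_unique)

abbreviation halfline :: "real \<Rightarrow> real measure" where
  "halfline t \<equiv> restrict_space (\<mu> t) {0..}"

lemma finite_halfline: "0 \<le> t \<Longrightarrow> finite_measure (halfline t)"
  by (intro finite_measure_restrict_space finite_mu) simp_all

lemma sets_halfline: "0 \<le> t \<Longrightarrow> sets (halfline t) = sets (restrict_space borel {0..})"
  by (intro sets_restrict_space_cong) simp

lemma space_halfline: "0 \<le> t \<Longrightarrow> space (halfline t) = {0..}"
  by (simp add: space_restrict_space)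

lemma measure_halfline_le: "0 \<le> t \<Longrightarrow> measure (halfline t) (space (halfline t)) \<le> 1"
  using emeasure_mu_le[of t "{0..}"]
  by (simp add: space_halfline emeasure_restrict_space measure_def enn2real_leI)

text \<open>The extension by \<open>max 0\<close> is continuous on the whole line, hence Borel, and
  changes the integrand only on the null set of negative reals. This links the half-line with the
  convolution, which lives on the line.\<close>

lemma integral_halfline:
  fixes g :: "real \<Rightarrow> 'b::{banach, second_countable_topology}"
  assumes t: "0 \<le> t" and g: "continuous_on {0..} g"
  shows "(\<integral>s. g s \<partial>halfline t) = (\<integral>s. g (max 0 s) \<partial>\<mu> t)"
proof -
  have "(\<integral>s. g s \<partial>halfline t) = (\<integral>s. indicator {0..} s *\<^sub>R g s \<partial>\<mu> t)"
    using t by (intro integral_restrict_space) simp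
  also have "\<dots> = (\<integral>s. g (max 0 s) \<partial>\<mu> t)"
  proof (rule integral_cong_AE)
    show "(\<lambda>s. indicator {0..} s *\<^sub>R g s) \<in> borel_measurable (\<mu> t)"
      using borel_measurable_continuous_on_indicator[OF _ g] t
      by (simp cong: measurable_cong_sets)
    have "continuous_on UNIV (\<lambda>s. g (max 0 s))"
      by (rule continuous_on_compose2[OF g]) (auto intro!: continuous_intros)
    then show "(\<lambda>s. g (max 0 s)) \<in> borel_measurable (\<mu> t)"
      using borel_measurable_continuous_onI t by (simp cong: measurable_cong_sets)
    show "AE s in \<mu> t. indicator {0..} s *\<^sub>R g s = g (max 0 s)"
      using mu_nonneg[OF t] by eventually_elim (simp add: max_def)
  qed
  finally show ?thesis .
qed

lemma integral_halfline_0: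
  fixes g :: "real \<Rightarrow> 'b::{banach, second_countable_topology}"
  assumes g: "continuous_on {0..} g"
  shows "(\<integral>s. g s \<partial>halfline 0) = g 0"
proof -
  have "continuous_on UNIV (\<lambda>s. g (max 0 s))"
    by (rule continuous_on_compose2[OF g]) (auto intro!: continuous_intros)
  then have "(\<integral>s. g (max 0 s) \<partial>return borel 0) = g (max 0 0)"
    by (intro integral_return borel_measurable_continuous_onI) simp_all
  then show ?thesis
    using integral_halfline[OF order_refl g] convolution by (simp add: convolution_semigroup_def)
qed

lemma mu_add: "0 \<le> s \<Longrightarrow> 0 \<le> t \<Longrightarrow> \<mu> (s + t) = distr (\<mu> s \<Otimes>\<^sub>M \<mu> t) borel (\<lambda>(x, y). x + y)"
  using convolution by (simp add: convolution_semigroup_def convolution_def)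

lemma measurable_add_mu [measurable]:
  "0 \<le> s \<Longrightarrow> 0 \<le> t \<Longrightarrow> (\<lambda>(x, y). x + y) \<in> borel_measurable (\<mu> s \<Otimes>\<^sub>M \<mu> t)"
  by (subst measurable_cong_sets[OF sets_pair_measure_cong[OF sets_mu sets_mu] refl]) simp_all

text \<open>\<open>\<mu> (s + t)\<close> is the image of a product measure under addition, so this
  is a change of variables followed by Fubini; the bound \<open>K\<close> gives integrability on the
  finite product.\<close>

lemma integral_halfline_convolution:
  fixes g :: "real \<Rightarrow> 'b::{banach, second_countable_topology}"
  assumes s: "0 \<le> s" and t: "0 \<le> t" and g: "continuous_on {0..} g"
    and bound: "\<And>r. 0 \<le> r \<Longrightarrow> norm (g r) \<le> K"
  shows "(\<integral>r. g r \<partial>halfline (s + t)) = (\<integral>r. (\<integral>q. g (r + q) \<partial>halfline t) \<partial>halfline s)"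
proof -
  interpret s: finite_measure "\<mu> s" by (rule finite_mu[OF s])
  interpret t: finite_measure "\<mu> t" by (rule finite_mu[OF t])
  interpret pair_sigma_finite "\<mu> s" "\<mu> t" ..
  have fin: "finite_measure (\<mu> s \<Otimes>\<^sub>M \<mu> t)"
    by (rule finite_measure_pair_measure) unfold_locales
  define h where "h r = g (max 0 r)" for r
  have "continuous_on UNIV h"
    unfolding h_def by (rule continuous_on_compose2[OF g]) (auto intro!: continuous_intros)
  then have h: "h \<in> borel_measurable borel"
    by (rule borel_measurable_continuous_onI)
  have h_add: "(\<lambda>z. h (case z of (x, y) \<Rightarrow> x + y)) \<in> borel_measurable (\<mu> s \<Otimes>\<^sub>M \<mu> t)"
    by (rule measurable_compose[OF measurable_add_mu[OF s t] h])
  have int: "integrable (\<mu> s \<Otimes>\<^sub>M \<mu> t) (\<lambda>z. h (case z of (x, y) \<Rightarrow> x + y))"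
    using bound by (intro finite_measure.integrable_const_bound[OF fin, of _ K] h_add)
      (auto simp: h_def)
  define \<Psi> where "\<Psi> x = (\<integral>y. h (x + y) \<partial>\<mu> t)" for x
  have \<Psi>_meas: "\<Psi> \<in> borel_measurable (\<mu> s)"
    unfolding \<Psi>_def[abs_def]
    by (intro t.borel_measurable_lebesgue_integral) (use h_add in \<open>simp add: case_prod_unfold\<close>)
  have "(\<integral>r. g r \<partial>halfline (s + t)) = (\<integral>r. h r \<partial>\<mu> (s + t))"
    using s t by (simp add: integral_halfline[OF _ g] h_def)
  also have "\<dots> = (\<integral>z. h (case z of (x, y) \<Rightarrow> x + y) \<partial>(\<mu> s \<Otimes>\<^sub>M \<mu> t))"
    unfolding mu_add[OF s t] by (rule integral_distr[OF measurable_add_mu[OF s t] h])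
  also have "\<dots> = (\<integral>x. \<Psi> x \<partial>\<mu> s)"
    using integral_fst'[OF int] by (simp add: \<Psi>_def)
  also have "\<dots> = (\<integral>x. indicator {0..} x *\<^sub>R \<Psi> x \<partial>\<mu> s)"
  proof (rule integral_cong_AE[OF \<Psi>_meas])
    show "(\<lambda>x. indicator {0..} x *\<^sub>R \<Psi> x) \<in> borel_measurable (\<mu> s)"
      using \<Psi>_meas s by (intro borel_measurable_scaleR borel_measurable_indicator) simp_all
    show "AE x in \<mu> s. \<Psi> x = indicator {0..} x *\<^sub>R \<Psi> x"
      using mu_nonneg[OF s] by eventually_elim simp
  qed
  also have "\<dots> = (\<integral>x. \<Psi> x \<partial>halfline s)"
    using s by (intro integral_restrict_space[symmetric]) simp
  also have "\<dots> = (\<integral>r. (\<integral>q. g (r + q) \<partial>halfline t) \<partial>halfline s)"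
  proof (rule Bochner_Integration.integral_cong[OF refl])
    fix r assume "r \<in> space (halfline s)"
    then have r: "0 \<le> r" by (simp add: space_halfline[OF s])
    have g': "continuous_on {0..} (\<lambda>q. g (r + q))"
      using r by (intro continuous_on_compose2[OF g] continuous_intros) auto
    have "continuous_on UNIV (\<lambda>q. g (r + max 0 q))"
      by (rule continuous_on_compose2[OF g']) (auto intro!: continuous_intros)
    then have m: "(\<lambda>q. g (r + max 0 q)) \<in> borel_measurable (\<mu> t)"
      using borel_measurable_continuous_onI t by (simp cong: measurable_cong_sets)
    have "(\<lambda>q. h (r + q)) \<in> borel_measurable (\<mu> t)"
      using measurable_compose[OF _ h, of "\<lambda>q. r + q" "\<mu> t"] t by (simp cong: measurable_cong_sets)
    \<comment> \<open>One side clips \<open>r + q\<close> at 0, the other clips \<open>q\<close>;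
      they can differ only for negative \<open>q\<close>, a null set.\<close>
    moreover have "AE q in \<mu> t. h (r + q) = g (r + max 0 q)"
      using mu_nonneg[OF t] by eventually_elim (use r in \<open>simp add: h_def max_def\<close>)
    ultimately show "\<Psi> r = (\<integral>q. g (r + q) \<partial>halfline t)"
      unfolding \<Psi>_def integral_halfline[OF t g'] using m by (intro integral_cong_AE)
  qed
  finally show ?thesis .
qed

section \<open>Vague continuity tested on functions supported in [0,1]\<close>

lemma vague_limit:
  fixes f :: "real \<Rightarrow> real"
  assumes f: "continuous_on {0..} f" and supp: "\<And>s. 1 < s \<Longrightarrow> f s = 0"
  shows "((\<lambda>t. \<integral>s. f s \<partial>halfline t) \<longlongrightarrow> f 0) (at_right 0)"
proof -
  have "{s \<in> {0..}. f s \<noteq> 0} \<subseteq> {0..1}"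
    using supp by force
  then have "closure {s \<in> {0..}. f s \<noteq> 0} \<subseteq> {0..1}"
    by (intro closure_minimal) auto
  then have "compact (closure {s \<in> {0..}. f s \<noteq> 0})"
    by (meson bounded_closed_interval bounded_subset closed_closure compact_eq_bounded_closed)
  then have "((\<lambda>t. LINT s:{0..}|\<mu> t. f s) \<longlongrightarrow> f 0) (at_right 0)"
    using vague f unfolding vaguely_continuous_at_0_def by blast
  then show ?thesis
  proof (rule Lim_transform_eventually)
    show "\<forall>\<^sub>F t in at_right 0. (LINT s:{0..}|\<mu> t. f s) = (\<integral>s. f s \<partial>halfline t)"
      using eventually_at_right_less[of 0]
      by eventually_elim (simp add: set_lebesgue_integral_def integral_restrict_space)
  qed
qed

text \<open>A tent with peak at 0. It exceeds 1 at negative arguments, hence the sign condition in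
  \<open>cutoff_bounds\<close>.\<close>

definition cutoff :: "real \<Rightarrow> real" where "cutoff s = max 0 (1 - s)"

lemma continuous_cutoff: "continuous_on A cutoff"
  unfolding cutoff_def by (intro continuous_intros)

lemma cutoff_bounds: "0 \<le> cutoff s" "0 \<le> s \<Longrightarrow> cutoff s \<le> 1"
  by (auto simp: cutoff_def)

lemma integral_cutoff_limit: "((\<lambda>t. \<integral>s. cutoff s \<partial>halfline t) \<longlongrightarrow> 1) (at_right 0)"
  using vague_limit[OF continuous_cutoff] by (simp add: cutoff_def)

lemma integrable_halfline:
  fixes g :: "real \<Rightarrow> 'b::{banach, second_countable_topology}"
  assumes "0 \<le> t" "continuous_on {0..} g" "\<And>s. 0 \<le> s \<Longrightarrow> norm (g s) \<le> K"
  shows "integrable (halfline t) g"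
  using integrable_halfline_bounded[OF finite_halfline sets_halfline] assms by blast

lemma integrable_cutoff: "0 \<le> t \<Longrightarrow> integrable (halfline t) cutoff"
  by (rule integrable_halfline[OF _ continuous_cutoff, of _ 1]) (auto simp: cutoff_def)

section \<open>Tails of the measures\<close>

abbreviation tail :: "real \<Rightarrow> real \<Rightarrow> real" where
  "tail t R \<equiv> measure (\<mu> t) {R<..}"

lemma tail_antimono: "0 \<le> t \<Longrightarrow> R \<le> R' \<Longrightarrow> tail t R' \<le> tail t R"
  by (intro finite_measure.finite_measure_mono finite_mu) auto

lemma integral_halfline_indicator:
  assumes "0 \<le> t" "0 \<le> R"
  shows "integrable (halfline t) (indicator {R<..} :: real \<Rightarrow> real)"
    and "(\<integral>s. indicator {R<..} s \<partial>halfline t) = tail t R"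
proof -
  interpret finite_measure "halfline t" by (rule finite_halfline[OF assms(1)])
  have "{R<..} \<in> sets (halfline t)" and eq: "{R<..} \<inter> space (halfline t) = {R<..}"
    using assms by (auto simp: space_halfline sets_restrict_space image_iff intro!: bexI[of _ "{R<..}"])
  then show "integrable (halfline t) (indicator {R<..} :: real \<Rightarrow> real)"
    by (simp add: integrable_indicator_iff less_top[symmetric])
  have "{R<..} \<subseteq> {0::real..}" using assms by auto
  then show "(\<integral>s. indicator {R<..} s \<partial>halfline t) = tail t R"
    using assms eq by (simp add: measure_restrict_space)
qed

text \<open>On the half-line \<open>cutoff\<close> plus the indicator of \<open>{1<..}\<close> is at
  most 1, so \<open>tail t 1\<close> is bounded by 1 minus the integral of
  \<open>cutoff\<close>.\<close>

lemma tail_small_time: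
  assumes "0 < e"
  obtains \<delta> where "0 < \<delta>" "\<And>t. 0 \<le> t \<Longrightarrow> t < \<delta> \<Longrightarrow> tail t 1 \<le> e"
proof -
  have "\<forall>\<^sub>F t in at_right 0. 1 - e < (\<integral>s. cutoff s \<partial>halfline t)"
    using order_tendstoD(1)[OF integral_cutoff_limit, of "1 - e"] assms by simp
  then obtain \<delta> where \<delta>: "0 < \<delta>" "\<And>t. 0 < t \<Longrightarrow> t < \<delta> \<Longrightarrow> 1 - e < (\<integral>s. cutoff s \<partial>halfline t)"
    by (auto simp: eventually_at_right_field)
  show ?thesis
  proof (rule that[OF \<delta>(1)])
    fix t assume t: "0 \<le> t" "t < \<delta>"
    show "tail t 1 \<le> e"
    \<comment> \<open>The limit from the right does not see t = 0; there the measure is the point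
      mass at 0.\<close>
    proof (cases "t = 0")
      case True
      then show ?thesis
        using convolution assms by (simp add: convolution_semigroup_def measure_return)
    next
      case False
      interpret finite_measure "halfline t" by (rule finite_halfline[OF t(1)])
      have "(\<integral>s. cutoff s + indicator {1<..} s \<partial>halfline t) \<le> (\<integral>s. 1 \<partial>halfline t)"
      proof (rule integral_mono)
        show "integrable (halfline t) (\<lambda>s. cutoff s + indicator {1<..} s)"
          by (intro Bochner_Integration.integrable_add integrable_cutoff t(1)
              integral_halfline_indicator(1)) simp
      qed (auto simp: cutoff_def indicator_def space_halfline[OF t(1)])
      also have "\<dots> \<le> 1"
        using measure_halfline_le[OF t(1)] by simp
      finally have "(\<integral>s. cutoff s \<partial>halfline t) + tail t 1 \<le> 1"
        using integral_halfline_indicator[of t 1] integrable_cutoff t(1) by simp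
      then show ?thesis using \<delta>(2)[of t] t False by simp
    qed
  qed
qed

lemma tail_vanishes:
  assumes t: "0 \<le> t" and e: "0 < e"
  obtains R where "0 \<le> R" "tail t R \<le> e"
proof -
  interpret finite_measure "\<mu> t" by (rule finite_mu[OF t])
  have "(\<lambda>n. tail t (real n)) \<longlonglongrightarrow> measure (\<mu> t) (\<Inter>n. {real n<..})"
    using t by (intro finite_Lim_measure_decseq) (auto simp: decseq_def)
  moreover have "x \<notin> (\<Inter>n. {real n<..})" for x
  proof -
    obtain n where "x < real n" using reals_Archimedean2 by blast
    then have "x \<notin> {real n<..}" by simp
    then show ?thesis by blast
  qed
  then have "(\<Inter>n. {real n<..}) = {}" by blast
  ultimately have "(\<lambda>n. tail t (real n)) \<longlonglongrightarrow> 0" by simp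
  then have "\<forall>\<^sub>F n in sequentially. tail t (real n) < e"
    by (rule order_tendstoD(2)[OF _ e])
  then obtain n where "tail t (real n) < e"
    by (auto simp: eventually_sequentially)
  then show ?thesis using that[of "real n"] by simp
qed

text \<open>If x + y > a + b, then x > a or y > b; in each case the other factor has mass at most
  1.\<close>

lemma tail_add:
  assumes s: "0 \<le> s" and t: "0 \<le> t"
  shows "tail (s + t) (a + b) \<le> tail s a + tail t b"
proof -
  interpret s: finite_measure "\<mu> s" by (rule finite_mu[OF s])
  interpret t: finite_measure "\<mu> t" by (rule finite_mu[OF t])
  interpret P: finite_measure "\<mu> s \<Otimes>\<^sub>M \<mu> t"
    by (rule finite_measure_pair_measure) unfold_locales
  have space: "space (\<mu> s \<Otimes>\<^sub>M \<mu> t) = UNIV"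
    using s t by (simp add: space_pair_measure)
  have sets: "{a<..} \<times> UNIV \<in> sets (\<mu> s \<Otimes>\<^sub>M \<mu> t)" "UNIV \<times> {b<..} \<in> sets (\<mu> s \<Otimes>\<^sub>M \<mu> t)"
    using s t by (intro pair_measureI; simp)+
  have one: "measure (\<mu> s) UNIV \<le> 1" "measure (\<mu> t) UNIV \<le> 1"
    using emeasure_mu_le[OF s, of UNIV] emeasure_mu_le[OF t, of UNIV]
    by (simp_all add: measure_def enn2real_leI)
  have prod: "measure (\<mu> s \<Otimes>\<^sub>M \<mu> t) (A \<times> B) = measure (\<mu> s) A * measure (\<mu> t) B"
    if "A \<in> sets borel" "B \<in> sets borel" for A B
    using that s t t.emeasure_pair_measure_Times[of A "\<mu> s" B]
    by (simp add: measure_def enn2real_mult)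
  have "tail (s + t) (a + b) = measure (\<mu> s \<Otimes>\<^sub>M \<mu> t) ((\<lambda>(x, y). x + y) -` {a + b<..} \<inter> UNIV)"
    unfolding mu_add[OF s t] space[symmetric] using s t by (intro measure_distr) auto
  also have "\<dots> \<le> measure (\<mu> s \<Otimes>\<^sub>M \<mu> t) ({a<..} \<times> UNIV \<union> UNIV \<times> {b<..})"
    using sets by (intro P.finite_measure_mono) auto
  also have "\<dots> \<le> measure (\<mu> s \<Otimes>\<^sub>M \<mu> t) ({a<..} \<times> UNIV) + measure (\<mu> s \<Otimes>\<^sub>M \<mu> t) (UNIV \<times> {b<..})"
    by (rule measure_Un_le[OF sets])
  also have "\<dots> \<le> tail s a + tail t b"
    using mult_left_mono[OF one(2), of "tail s a"] mult_right_mono[OF one(1), of "tail t b"]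
    by (simp add: prod)
  finally show ?thesis .
qed

text \<open>
  Write \<open>t = k \<delta> + r\<close> with \<open>0 \<le> r < \<delta>\<close>: the tails at times below \<open>\<delta>\<close> are small by vague
  continuity at \<open>0\<close>, and only finitely many measures \<open>\<mu> (k \<delta>)\<close> occur. No continuity of
  \<open>\<mu>\<close> at positive times is used.
\<close>
lemma tail_uniform:
  assumes e: "0 < e"
  obtains R where "0 \<le> R" "\<And>t. 0 \<le> t \<Longrightarrow> t \<le> t0 \<Longrightarrow> tail t R \<le> e"
proof -
  obtain \<delta> where \<delta>: "0 < \<delta>" "\<And>t. 0 \<le> t \<Longrightarrow> t < \<delta> \<Longrightarrow> tail t 1 \<le> e / 2"
    using tail_small_time[of "e / 2"] e by auto
  have "\<exists>R. 0 \<le> R \<and> tail (real k * \<delta>) R \<le> e / 2" for k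
  proof -
    have "0 \<le> real k * \<delta>" "0 < e / 2" using \<delta>(1) e by simp_all
    then show ?thesis by (rule tail_vanishes) blast
  qed
  then obtain \<rho> where \<rho>: "\<And>k. 0 \<le> \<rho> k" "\<And>k. tail (real k * \<delta>) (\<rho> k) \<le> e / 2"
    by metis
  \<comment> \<open>A sum of nonnegative levels dominates each of them and serves as a maximum over
    the finitely many relevant \<open>k\<close>.\<close>
  define R where "R = (\<Sum>k\<le>nat \<lfloor>t0 / \<delta>\<rfloor>. \<rho> k)"
  show ?thesis
  \<comment> \<open>The added 1 is the level at which the remainder time \<open>r\<close> has a
    small tail.\<close>
  proof (rule that[of "R + 1"])
    show "0 \<le> R + 1" using \<rho>(1) by (simp add: R_def sum_nonneg)
    fix t assume t: "0 \<le> t" "t \<le> t0"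
    define k where "k = nat \<lfloor>t / \<delta>\<rfloor>"
    define r where "r = t - real k * \<delta>"
    have "real k = of_int \<lfloor>t / \<delta>\<rfloor>" using t \<delta>(1) by (simp add: k_def)
    then have "real k \<le> t / \<delta>" "t / \<delta> < real k + 1" by linarith+
    then have r: "0 \<le> r" "r < \<delta>"
      using \<delta>(1) by (simp_all add: r_def field_simps)
    have "k \<le> nat \<lfloor>t0 / \<delta>\<rfloor>"
      unfolding k_def using t \<delta>(1) by (intro nat_mono floor_mono divide_right_mono) auto
    then have "\<rho> k \<le> R"
      unfolding R_def using \<rho>(1) by (intro member_le_sum) auto
    have "tail t (R + 1) = tail (real k * \<delta> + r) (R + 1)" by (simp add: r_def)
    also have "\<dots> \<le> tail (real k * \<delta>) R + tail r 1"
      using r \<delta>(1) by (intro tail_add) auto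
    also have "\<dots> \<le> tail (real k * \<delta>) (\<rho> k) + tail r 1"
      using \<open>\<rho> k \<le> R\<close> \<delta>(1) by (intro add_right_mono tail_antimono) auto
    also have "\<dots> \<le> e"
      using \<rho>(2)[of k] \<delta>(2)[OF r] by simp
    finally show "tail t (R + 1) \<le> e" .
  qed
qed

end

subsection \<open>Subordination\<close>

text \<open>Below any positive extended real lies a positive finite one. The weak inequality suits
  suprema, which are bounded by bounding each member.\<close>

lemma tendsto_zero_ennrealI:
  fixes f :: "'b \<Rightarrow> ennreal"
  assumes "\<And>e::real. 0 < e \<Longrightarrow> \<forall>\<^sub>F x in F. f x \<le> ennreal e"
  shows "(f \<longlongrightarrow> 0) F"
proof (rule order_tendstoI)
  fix a :: ennreal assume "0 < a"
  then obtain b where b: "0 < b" "b < a" using dense by blast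
  then have "b < \<infinity>" by (simp add: less_le_trans)
  then have "0 < enn2real b" "ennreal (enn2real b) = b"
    using b by (simp_all add: enn2real_positive_iff)
  then have "\<forall>\<^sub>F x in F. f x \<le> b" using assms by metis
  then show "\<forall>\<^sub>F x in F. f x < a"
    by (rule eventually_mono) (use b in auto)
qed simp

locale subordination =
  equibounded_C0_semigroup sc \<tau> I p T + vaguely_continuous_convolution_semigroup \<mu>
  for sc :: "'k::{real_normed_field, euclidean_space} \<Rightarrow> 'a::ab_group_add \<Rightarrow> 'a"
    and \<tau> :: "'a topology" and I :: "'i set" and p :: "'i \<Rightarrow> 'a \<Rightarrow> real"
    and T :: "real \<Rightarrow> 'a \<Rightarrow> 'a" and \<mu> :: "real \<Rightarrow> real measure"
begin

abbreviation S :: "real \<Rightarrow> 'a \<Rightarrow> 'a" where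
  "S \<equiv> subordinated_semigroup sc \<tau> \<mu> T"

lemma
  assumes "0 \<le> t"
  shows S_pettis: "has_pettis_integral sc \<tau> (halfline t) (\<lambda>s. T s x) (S t x)"
    and S_functional: "\<phi> \<in> seq_dual \<Longrightarrow> has_bochner_integral (halfline t) (\<lambda>s. \<phi> (T s x)) (\<phi> (S t x))"
  unfolding subordinated_semigroup_def
  by (rule pettis_integral_functional[OF finite_halfline[OF assms] sets_halfline[OF assms]
        orbit_continuous orbit_bounded], assumption?)+

section \<open>Algebraic laws for \<open>S\<close>\<close>

lemma S_linear:
  assumes t: "0 \<le> t"
  shows "Vector_Spaces.linear sc sc (S t)"
proof (intro module_hom_iff_linear[THEN iffD1] module_hom.intro module_hom_axioms.intro vs.module_axioms)
  fix x y c
  show "S t (x + y) = S t x + S t y"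
  proof (rule seq_dual_eqI)
    fix \<phi> assume \<phi>: "\<phi> \<in> seq_dual"
    have sum: "has_bochner_integral (halfline t) (\<lambda>s. \<phi> (T s x) + \<phi> (T s y)) (\<phi> (S t x) + \<phi> (S t y))"
      by (intro has_bochner_integral_add S_functional t \<phi>)
    have "has_bochner_integral (halfline t) (\<lambda>s. \<phi> (T s (x + y))) (\<phi> (S t x + S t y))"
      unfolding seq_dualD(1)[OF \<phi>]
      by (rule has_bochner_integral_cong[THEN iffD1, OF refl _ refl sum])
        (simp add: T_plus seq_dualD(1)[OF \<phi>] space_halfline[OF t])
    then show "\<phi> (S t (x + y)) = \<phi> (S t x + S t y)"
      by (rule has_bochner_integral_eq[OF S_functional[OF t \<phi>]])
  qed
  show "S t (sc c x) = sc c (S t x)"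
  proof (rule seq_dual_eqI)
    fix \<phi> assume \<phi>: "\<phi> \<in> seq_dual"
    have scaled: "has_bochner_integral (halfline t) (\<lambda>s. c * \<phi> (T s x)) (c * \<phi> (S t x))"
      by (intro has_bochner_integral_mult_right S_functional t \<phi>)
    have "has_bochner_integral (halfline t) (\<lambda>s. \<phi> (T s (sc c x))) (\<phi> (sc c (S t x)))"
      unfolding seq_dualD(3)[OF \<phi>]
      by (rule has_bochner_integral_cong[THEN iffD1, OF refl _ refl scaled])
        (simp add: T_scale seq_dualD(3)[OF \<phi>] space_halfline[OF t])
    then show "\<phi> (S t (sc c x)) = \<phi> (sc c (S t x))"
      by (rule has_bochner_integral_eq[OF S_functional[OF t \<phi>]])
  qed
qed

lemma S_zero: "S 0 x = x"
proof (rule seq_dual_eqI)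
  fix \<phi> assume \<phi>: "\<phi> \<in> seq_dual"
  have "\<phi> (S 0 x) = (\<integral>s. \<phi> (T s x) \<partial>halfline 0)"
    using S_functional[OF order_refl \<phi>] by (simp add: has_bochner_integral_iff)
  also have "\<dots> = \<phi> x"
    using integral_halfline_0[OF halfline_continuous_functional[OF orbit_continuous \<phi>]]
    by (simp add: T_zero)
  finally show "\<phi> (S 0 x) = \<phi> x" .
qed

lemma S_add:
  assumes s: "0 \<le> s" and t: "0 \<le> t"
  shows "S (s + t) x = S s (S t x)"
proof (rule seq_dual_eqI)
  fix \<phi> assume \<phi>: "\<phi> \<in> seq_dual"
  obtain K where K: "\<And>y. y \<in> (\<lambda>s. T s x) ` {0..} \<Longrightarrow> norm (\<phi> y) \<le> K"
    using seq_dual_bounded[OF \<phi> orbit_bounded] by blast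
  have "\<phi> (S (s + t) x) = (\<integral>r. \<phi> (T r x) \<partial>halfline (s + t))"
    using S_functional[OF _ \<phi>, of "s + t" x] s t by (simp add: has_bochner_integral_iff)
  also have "\<dots> = (\<integral>r. (\<integral>q. \<phi> (T (r + q) x) \<partial>halfline t) \<partial>halfline s)"
    using K by (intro integral_halfline_convolution[OF s t, of _ K]
        halfline_continuous_functional[OF orbit_continuous \<phi>]) auto
  also have "\<dots> = (\<integral>r. \<phi> (T r (S t x)) \<partial>halfline s)"
  proof (rule Bochner_Integration.integral_cong[OF refl])
    fix r assume "r \<in> space (halfline s)"
    then have r: "0 \<le> r" by (simp add: space_halfline[OF s])
    have "(\<integral>q. \<phi> (T (r + q) x) \<partial>halfline t) = (\<integral>q. \<phi> (T r (T q x)) \<partial>halfline t)"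
      using r by (intro Bochner_Integration.integral_cong[OF refl])
        (simp add: T_add space_halfline[OF t])
    also have "\<dots> = \<phi> (T r (S t x))"
      using S_functional[OF t seq_dual_compose_T[OF \<phi> r]] by (simp add: has_bochner_integral_iff)
    finally show "(\<integral>q. \<phi> (T (r + q) x) \<partial>halfline t) = \<phi> (T r (S t x))" .
  qed
  also have "\<dots> = \<phi> (S s (S t x))"
    using S_functional[OF s \<phi>] by (simp add: has_bochner_integral_iff)
  finally show "\<phi> (S (s + t) x) = \<phi> (S s (S t x))" .
qed

text \<open>With m the total mass of \<open>\<mu> t\<close>, \<open>S t x - x\<close> is the
  integral of \<open>T s x - x\<close> minus 1 - m times \<open>x\<close>. In the integral the part
  weighted by \<open>1 - cutoff s\<close> is bounded by \<open>K\<close>; both this part and the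
  missing mass are controlled by 1 minus the integral of \<open>cutoff\<close>, whence the factor
  \<open>K + p i x\<close>.\<close>

lemma S_minus_identity:
  assumes t: "0 \<le> t" and i: "i \<in> I" and K: "\<And>s. 0 \<le> s \<Longrightarrow> p i (T s x - x) \<le> K"
  shows "p i (S t x - x) \<le> (\<integral>s. p i (T s x - x) * cutoff s \<partial>halfline t) +
    (K + p i x) * (1 - (\<integral>s. cutoff s \<partial>halfline t))"
proof -
  interpret finite_measure "halfline t" by (rule finite_halfline[OF t])
  define m where "m = measure (halfline t) (space (halfline t))"
  have "0 \<le> p i (T 0 x - x)" using i by simp
  with K[of 0] have K0: "0 \<le> K" by linarith
  note cut = integrable_cutoff[OF t]
  have m: "m \<le> 1" unfolding m_def by (rule measure_halfline_le[OF t])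
  have cut_m: "(\<integral>s. cutoff s \<partial>halfline t) \<le> m"
  proof -
    have "(\<integral>s. cutoff s \<partial>halfline t) \<le> (\<integral>s. 1 \<partial>halfline t)"
      by (intro integral_mono cut integrable_const) (simp add: cutoff_bounds space_halfline[OF t])
    then show ?thesis by (simp add: m_def)
  qed
  have gh: "integrable (halfline t) (\<lambda>s. p i (T s x - x) * cutoff s)"
  proof (rule integrable_halfline[OF t])
    show "continuous_on {0..} (\<lambda>s. p i (T s x - x) * cutoff s)"
      by (intro continuous_on_mult halfline_continuous_seminorm orbit_continuous i continuous_cutoff)
    show "norm (p i (T s x - x) * cutoff s) \<le> K" if "0 \<le> s" for s
      using mult_mono[OF K[OF that] cutoff_bounds(2)[OF that]] K0 i
      by (simp add: cutoff_bounds abs_mult)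
  qed
  have const: "has_pettis_integral sc \<tau> (halfline t) (\<lambda>_. x) (sc (of_real m) x)"
  proof (rule has_pettis_integralI)
    fix \<phi> assume "\<phi> \<in> continuous_dual sc \<tau>"
    then have \<phi>: "\<phi> \<in> seq_dual" using continuous_dual_subset_seq_dual by blast
    show "has_bochner_integral (halfline t) (\<lambda>_. \<phi> x) (\<phi> (sc (of_real m) x))"
      by (simp add: has_bochner_integral_iff seq_dualD[OF \<phi>] m_def scaleR_conv_of_real)
  qed
  have "p i (S t x - sc (of_real m) x) \<le> (\<integral>s. p i (T s x - x) * cutoff s + K * (1 - cutoff s) \<partial>halfline t)"
  proof (rule has_pettis_integral_seminorm_le[OF has_pettis_integral_diff[OF S_pettis[OF t] const] i])
    show "integrable (halfline t) (\<lambda>s. p i (T s x - x) * cutoff s + K * (1 - cutoff s))"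
      using gh cut by simp
    fix s assume "s \<in> space (halfline t)"
    then have s: "0 \<le> s" by (simp add: space_halfline[OF t])
    have "p i (T s x - x) * (1 - cutoff s) \<le> K * (1 - cutoff s)"
      using K[OF s] cutoff_bounds(2)[OF s] by (intro mult_right_mono) auto
    then show "p i (T s x - x) \<le> p i (T s x - x) * cutoff s + K * (1 - cutoff s)"
      by (simp add: algebra_simps)
  qed
  also have "\<dots> = (\<integral>s. p i (T s x - x) * cutoff s \<partial>halfline t) + K * (m - (\<integral>s. cutoff s \<partial>halfline t))"
    using gh cut by (simp add: m_def)
  also have "\<dots> \<le> (\<integral>s. p i (T s x - x) * cutoff s \<partial>halfline t) + K * (1 - (\<integral>s. cutoff s \<partial>halfline t))"
    using m K0 by (intro add_left_mono mult_left_mono) auto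
  finally have 1: "p i (S t x - sc (of_real m) x) \<le> \<dots>" .
  have "sc (of_real m) x - x = sc (of_real (m - 1)) x"
    by (simp add: vs.scale_left_diff_distrib)
  then have "p i (sc (of_real m) x - x) = \<bar>m - 1\<bar> * p i x"
    by (simp only: seminorm_scale[OF i] norm_of_real)
  also have "\<dots> \<le> (1 - (\<integral>s. cutoff s \<partial>halfline t)) * p i x"
    using m cut_m i by (intro mult_right_mono) auto
  finally have 2: "p i (sc (of_real m) x - x) \<le> (1 - (\<integral>s. cutoff s \<partial>halfline t)) * p i x" .
  show ?thesis
    using 1 2 seminorm_triangle[OF i, of "S t x" x "sc (of_real m) x"]
    by (simp add: algebra_simps)
qed

lemma S_limit: "limitin \<tau> (\<lambda>t. S t x) x (at_right 0)"
  unfolding limitin_seminorm_iff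
proof
  fix i assume i: "i \<in> I"
  obtain C where "\<And>s. 0 \<le> s \<Longrightarrow> p i (T s x) \<le> C"
    using orbit_bounded[of x] i unfolding bounded_set_def bdd_above_def by (metis atLeast_iff imageI)
  then have K: "p i (T s x - x) \<le> C + p i x" if "0 \<le> s" for s
    using seminorm_diff[OF i, of "T s x" x] that by (metis add_right_mono order_trans)
  let ?cut = "\<lambda>t. \<integral>s. cutoff s \<partial>halfline t"
  let ?bound = "\<lambda>t. (\<integral>s. p i (T s x - x) * cutoff s \<partial>halfline t) + (C + p i x + p i x) * (1 - ?cut t)"
  \<comment> \<open>Multiplication by \<open>cutoff\<close> makes the orbit increment an admissible
    test function; its value at 0 is 0.\<close>
  have "((\<lambda>t. \<integral>s. p i (T s x - x) * cutoff s \<partial>halfline t) \<longlongrightarrow> p i (T 0 x - x) * cutoff 0) (at_right 0)"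
    by (intro vague_limit continuous_on_mult halfline_continuous_seminorm orbit_continuous i
        continuous_cutoff) (simp add: cutoff_def)
  then have "((\<lambda>t. \<integral>s. p i (T s x - x) * cutoff s \<partial>halfline t) \<longlongrightarrow> 0) (at_right 0)"
    using i by (simp add: T_zero)
  then have "(?bound \<longlongrightarrow> 0 + (C + p i x + p i x) * (1 - 1)) (at_right 0)"
    by (intro tendsto_intros integral_cutoff_limit)
  then have lim: "(?bound \<longlongrightarrow> 0) (at_right 0)" by simp
  show "((\<lambda>t. p i (S t x - x)) \<longlongrightarrow> 0) (at_right 0)"
  proof (rule tendsto_sandwich[OF _ _ tendsto_const lim])
    show "\<forall>\<^sub>F t in at_right 0. p i (S t x - x) \<le> ?bound t"
      using eventually_at_right_less[of 0]
      by eventually_elim (rule S_minus_identity[OF _ i K], simp_all)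
  qed (use i in simp)
qed

lemma C0_semigroup_S: "C0_semigroup sc \<tau> S"
  unfolding C0_semigroup_def
  using S_linear S_zero S_add S_limit by (simp add: fun_eq_iff)

text \<open>The orbit is majorised by \<open>e\<close> up to the level \<open>R\<close> and by
  \<open>K\<close> beyond it.\<close>

lemma S_seminorm_le:
  assumes t: "0 \<le> t" and i: "i \<in> I" and R: "0 \<le> R"
    and e: "\<And>s. 0 \<le> s \<Longrightarrow> s \<le> R \<Longrightarrow> p i (T s x) \<le> e" and K: "\<And>s. 0 \<le> s \<Longrightarrow> p i (T s x) \<le> K"
  shows "p i (S t x) \<le> e + K * tail t R"
proof -
  interpret finite_measure "halfline t" by (rule finite_halfline[OF t])
  note tail = integral_halfline_indicator[OF t R]
  have "0 \<le> p i (T 0 x)" using i by simp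
  \<comment> \<open>Nonnegativity of \<open>e\<close> serves twice: for the majorant beyond
    \<open>R\<close>, and to absorb a total mass of at most 1.\<close>
  with e[of 0] R have e0: "0 \<le> e" by linarith
  have "p i (S t x) \<le> (\<integral>s. e + K * indicator {R<..} s \<partial>halfline t)"
  proof (rule has_pettis_integral_seminorm_le[OF S_pettis[OF t] i])
    show "integrable (halfline t) (\<lambda>s. e + K * indicator {R<..} s)"
      by (intro Bochner_Integration.integrable_add integrable_const integrable_mult_right tail(1))
    fix s assume "s \<in> space (halfline t)"
    then have "0 \<le> s" by (simp add: space_halfline[OF t])
    then show "p i (T s x) \<le> e + K * indicator {R<..} s"
      using e[of s] K[of s] e0 by (cases "s \<le> R") auto
  qed
  also have "\<dots> = e * measure (halfline t) (space (halfline t)) + K * tail t R"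
    using tail by (simp add: Bochner_Integration.integral_add del: integrable_indicator_iff)
  also have "\<dots> \<le> e + K * tail t R"
    using mult_left_mono[OF measure_halfline_le[OF t] e0] by simp
  finally show ?thesis .
qed

text \<open>Averaging against mass at most 1 does not enlarge a bound on the orbit; equiboundedness
  and global equicontinuity pass to \<open>S\<close> with the same bounds.\<close>

lemma S_seminorm_le_const:
  assumes t: "0 \<le> t" and i: "i \<in> I" and K: "\<And>s. 0 \<le> s \<Longrightarrow> p i (T s x) \<le> K"
  shows "p i (S t x) \<le> K"
proof -
  interpret finite_measure "halfline t" by (rule finite_halfline[OF t])
  have "0 \<le> p i (T 0 x)" using i by simp
  with K[of 0] have K0: "0 \<le> K" by linarith
  have "p i (S t x) \<le> (\<integral>s. K \<partial>halfline t)"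
    using K by (intro has_pettis_integral_seminorm_le[OF S_pettis[OF t] i] integrable_const)
      (simp add: space_halfline[OF t])
  also have "\<dots> \<le> K"
    using mult_left_mono[OF measure_halfline_le[OF t] K0] by (simp add: mult.commute)
  finally show ?thesis .
qed

lemma equibounded_S: "equibounded I p S"
  unfolding equibounded_def
proof (intro allI impI ballI)
  fix B i assume B: "bounded_set I p B" and i: "i \<in> I"
  obtain K where K: "\<And>x t. x \<in> B \<Longrightarrow> 0 \<le> t \<Longrightarrow> p i (T t x) \<le> K"
    by (rule T_bounded[OF B i]) blast
  have "p i (S t x) \<le> K" if "x \<in> B" "0 \<le> t" for x t
    by (rule S_seminorm_le_const[OF that(2) i K[OF that(1)]])
  then have "(SUP (x, t)\<in>B \<times> {0..}. ennreal (p i (S t x))) \<le> ennreal K"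
    by (intro SUP_least) (auto intro: ennreal_leI)
  then show "(SUP (x, t)\<in>B \<times> {0..}. ennreal (p i (S t x))) < \<infinity>"
    by (rule le_less_trans) simp
qed

lemma locally_sequentially_equicontinuous_S: "locally_sequentially_equicontinuous \<tau> I p S"
  unfolding locally_sequentially_equicontinuous_def
proof (intro allI impI ballI tendsto_zero_ennrealI)
  fix x i and t0 e :: real
  assume x: "limitin \<tau> x 0 sequentially" and t0: "0 < t0" and i: "i \<in> I" and e: "0 < e"
  \<comment> \<open>A null sequence is bounded, so one \<open>K\<close> serves all its orbits. Thus
    \<open>R\<close> can be chosen from \<open>K\<close> and \<open>t0\<close> alone, before the
    index \<open>n\<close>.\<close>
  obtain K where K: "0 \<le> K" "\<And>y t. y \<in> range x \<Longrightarrow> 0 \<le> t \<Longrightarrow> p i (T t y) \<le> K"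
    by (rule T_bounded[OF bounded_set_convergent[OF x] i]) blast
  \<comment> \<open>The denominator contains \<open>K + 1\<close> because \<open>K\<close> may be
    0.\<close>
  define \<epsilon> where "\<epsilon> = e / (2 * (K + 1))"
  have \<epsilon>: "0 < \<epsilon>" "K * \<epsilon> \<le> e / 2"
    using e K(1) by (simp_all add: \<epsilon>_def field_simps)
  obtain R where R: "0 \<le> R" "\<And>t. 0 \<le> t \<Longrightarrow> t \<le> t0 \<Longrightarrow> tail t R \<le> \<epsilon>"
    using tail_uniform[OF \<epsilon>(1)] by blast
  \<comment> \<open>\<open>R\<close> may be 0, so the interval is lengthened to have positive
    length.\<close>
  have "\<forall>\<^sub>F n in sequentially. \<forall>s\<in>{0..R + 1}. p i (T s (x n)) < e / 2"
    using e R(1) by (intro T_local_equicont[OF x i]) auto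
  then show "\<forall>\<^sub>F n in sequentially. (SUP t\<in>{0..t0}. ennreal (p i (S t (x n)))) \<le> ennreal e"
  proof (rule eventually_mono, intro SUP_least ennreal_leI)
    fix n and t :: real
    assume small: "\<forall>s\<in>{0..R + 1}. p i (T s (x n)) < e / 2" and t: "t \<in> {0..t0}"
    have small': "p i (T s (x n)) \<le> e / 2" if "0 \<le> s" "s \<le> R" for s
    proof -
      have "s \<in> {0..R + 1}" using that by simp
      then show ?thesis using small less_imp_le by blast
    qed
    have "p i (S t (x n)) \<le> e / 2 + K * tail t R"
      using t by (intro S_seminorm_le i R(1) small' K(2)) auto
    also have "K * tail t R \<le> K * \<epsilon>"
      using K(1) R(2) t by (intro mult_left_mono) auto
    finally show "p i (S t (x n)) \<le> e" using \<epsilon>(2) by simp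
  qed
qed

lemma sequentially_equicontinuous_S:
  assumes "sequentially_equicontinuous \<tau> I p T"
  shows "sequentially_equicontinuous \<tau> I p S"
  unfolding sequentially_equicontinuous_def
proof (intro allI impI ballI tendsto_zero_ennrealI)
  fix x i and e :: real
  assume x: "limitin \<tau> x 0 sequentially" and i: "i \<in> I" and e: "0 < e"
  have "(\<lambda>n. SUP t\<in>{0..}. ennreal (p i (T t (x n)))) \<longlonglongrightarrow> 0"
    using assms x i by (simp add: sequentially_equicontinuous_def)
  then have "\<forall>\<^sub>F n in sequentially. (SUP t\<in>{0..}. ennreal (p i (T t (x n)))) < ennreal e"
    by (rule order_tendstoD(2)) (use e in simp)
  then show "\<forall>\<^sub>F n in sequentially. (SUP t\<in>{0..}. ennreal (p i (S t (x n)))) \<le> ennreal e"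
  proof (rule eventually_mono, intro SUP_least ennreal_leI)
    fix n t assume n: "(SUP t\<in>{0..}. ennreal (p i (T t (x n)))) < ennreal e" and t: "t \<in> {0::real..}"
    have "p i (T s (x n)) \<le> e" if "0 \<le> s" for s
    proof -
      have "ennreal (p i (T s (x n))) < ennreal e"
        by (rule le_less_trans[OF SUP_upper n]) (use that in simp)
      then show ?thesis using i by (simp add: ennreal_less_iff)
    qed
    then show "p i (S t (x n)) \<le> e"
      using t by (intro S_seminorm_le_const[OF _ i]) auto
  qed
qed

end

theorem proposition4p9:
  fixes sc :: "'k::{real_normed_field, euclidean_space} \<Rightarrow> 'a::ab_group_add \<Rightarrow> 'a"
    and \<tau> :: "'a topology"
    and I :: "'i set"
    and p :: "'i \<Rightarrow> 'a \<Rightarrow> real"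
    and T :: "real \<Rightarrow> 'a \<Rightarrow> 'a"
    and \<mu> :: "real \<Rightarrow> real measure"
  assumes "locally_convex_space sc \<tau> I p"
    and "Hausdorff_space \<tau>"
    and "sequentially_complete \<tau> I p"
    and "C0_semigroup sc \<tau> T"
    and "locally_sequentially_equicontinuous \<tau> I p T"
    and "equibounded I p T"
    and "subprob_family \<mu>"
    and "convolution_semigroup \<mu>"
    and "vaguely_continuous_at_0 \<mu>"
  shows "(\<forall>t\<ge>0. \<forall>x. pettis_integrable sc \<tau> (restrict_space (\<mu> t) {0..}) (\<lambda>s. T s x)) \<and>
         C0_semigroup sc \<tau> (subordinated_semigroup sc \<tau> \<mu> T) \<and>
         locally_sequentially_equicontinuous \<tau> I p (subordinated_semigroup sc \<tau> \<mu> T) \<and>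
         equibounded I p (subordinated_semigroup sc \<tau> \<mu> T) \<and>
         (sequentially_equicontinuous \<tau> I p T \<longrightarrow>
            sequentially_equicontinuous \<tau> I p (subordinated_semigroup sc \<tau> \<mu> T))"
proof -
  interpret subordination sc \<tau> I p T \<mu>
    using assms by unfold_locales
  show ?thesis
    using S_pettis C0_semigroup_S locally_sequentially_equicontinuous_S equibounded_S
      sequentially_equicontinuous_S
    unfolding pettis_integrable_def by blast
qed

end
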